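(* For every $\eta>0$ there exists $n_0$ such that for every even integer $n\ge n_0$ and every graph $G$ on $(2+\eta)n$ vertices with minimum degree $\delta(G)\ge (7/4+4\eta)n$, every colouring of the edges of $G$ with three colours yields a monochromatic component which contains a matching saturating $n$ vertices.
   Context: For an edge-colouring of $G=(V,E)$ with colours $1,2,3$, let $G_i=(V,E_i)$ be the spanning subgraph formed by the edges of colour $i$. A monochromatic component (of colour $i$) is a connected component of $G_i$; a matching contained in it consists of edges of colour $i$ of that component. A matching saturates $k$ vertices if it covers $k$ vertices (i.e. has $k/2$ edges). *)

theory Defs
  imports Complex_Main "HOL-Library.Ramsey" "HOL-Library.Disjoint_Sets"
begin

definition simple_graph :: "'a set \<Rightarrow> 'a set set \<Rightarrow> bool" where
  "simple_graph V E \<longleftrightarrow> finite V \<and> E \<subseteq> [V]\<^bsup>2\<^esup>"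

definition vertex_degree :: "'a set set \<Rightarrow> 'a \<Rightarrow> nat" where
  "vertex_degree E v = card {e \<in> E. v \<in> e}"

(* Meaningful only for finite nonempty V. *)
definition min_degree :: "'a set \<Rightarrow> 'a set set \<Rightarrow> nat" where
  "min_degree V E = Min (vertex_degree E ` V)"

definition colour_class :: "'a set set \<Rightarrow> ('a set \<Rightarrow> nat) \<Rightarrow> nat \<Rightarrow> 'a set set" where
  "colour_class E c i = {e \<in> E. c e = i}"

(* Components are given by their vertex sets; isolated vertices form singleton components. *)
definition graph_components :: "'a set \<Rightarrow> 'a set set \<Rightarrow> 'a set set" where
  "graph_components V E = V // {(u, v). u \<in> V \<and> v \<in> V \<and> (u, v) \<in> {(x, y). {x, y} \<in> E}\<^sup>*}"

definition matching :: "'a set set \<Rightarrow> 'a set set \<Rightarrow> bool" where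
  "matching E M \<longleftrightarrow> M \<subseteq> E \<and> disjoint M"

(* C is the vertex set of a component of the graph with edge set F, so the edges of that
   component are the members of F lying inside C. *)
definition component_matching :: "'a set set \<Rightarrow> 'a set \<Rightarrow> 'a set set \<Rightarrow> bool" where
  "component_matching F C M \<longleftrightarrow> matching {e \<in> F. e \<subseteq> C} M"

definition saturates :: "'a set set \<Rightarrow> nat \<Rightarrow> bool" where
  "saturates M k \<longleftrightarrow> card (\<Union>M) = k"

(* "On x vertices" for a real number x: the order is x rounded to an integer, in either direction.
   If x is an integer, this says exactly that the order is x. *)
definition has_order :: "'a set \<Rightarrow> real \<Rightarrow> bool" where
  "has_order V x \<longleftrightarrow> int (card V) = \<lfloor>x\<rfloor> \<or> int (card V) = \<lceil>x\<rceil>"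

end

theory Submission
  imports Defs
begin

text \<open>If a component of a colour has no matching saturating \<open>n\<close> vertices, then by a weak form of the
  Tutte--Berge formula its vertices carry weights in \<open>{0, 1/2, 1}\<close> of total at most \<open>n/2 + O(1)\<close> such
  that, except for few edges at each vertex (those inside small blocks), the ends of every edge have
  total weight at least \<open>1\<close>. Let \<open>N = n + O(1)\<close> be twice the bound on the weight of a component, and
  keep only \<open>2 * N + 1\<close> vertices. At most one component of a colour now has more than \<open>N\<close> vertices. If
  there is one, record for each vertex its weight there, or that it lies outside; if there is
  none, the components can be grouped into three unions of at most \<open>N\<close> vertices each. Each vertex thus
  has one of at most \<open>64\<close> triples of states, and triples that are not linked in any colour are
  never joined by one of the remaining edges. So the frequencies of the triples satisfy the size
  bounds of the colours, and for each triple that occurs those not linked to it have total frequency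
  at most \<open>N/4\<close>, as the minimum degree is large. This finite system forces
  at most \<open>2 * N\<close> vertices: distinguish cases according to which triples occur, and in each case add up
  the inequalities with multipliers found by linear programming.\<close>

section \<open>Maximum matchings as involutions\<close>

text \<open>A matching is encoded as an involution of the whole type whose fixed points are the
  unmatched vertices. Two matchings can then be spliced along any set invariant under both by a case
  distinction.\<close>

definition pairing :: "'a set set \<Rightarrow> ('a \<Rightarrow> 'a) \<Rightarrow> bool" where
  "pairing F m \<longleftrightarrow> (\<forall>v. m (m v) = v) \<and> (\<forall>v. m v \<noteq> v \<longrightarrow> {v, m v} \<in> F)"

definition covered :: "('a \<Rightarrow> 'a) \<Rightarrow> 'a set" where
  "covered m = {v. m v \<noteq> v}"

definition maximum_pairing :: "'a set set \<Rightarrow> ('a \<Rightarrow> 'a) \<Rightarrow> bool" where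
  "maximum_pairing F m \<longleftrightarrow> pairing F m \<and> (\<forall>m'. pairing F m' \<longrightarrow> card (covered m') \<le> card (covered m))"

definition pairing_edges :: "('a \<Rightarrow> 'a) \<Rightarrow> 'a set set" where
  "pairing_edges m = (\<lambda>v. {v, m v}) ` covered m"

lemma covered_subset:
  assumes "pairing F m" "F \<subseteq> [V]\<^bsup>2\<^esup>"
  shows "covered m \<subseteq> V"
  using assms by (auto simp: pairing_def covered_def nsets_def)

lemma card_covered_le:
  assumes "pairing F m" "F \<subseteq> [V]\<^bsup>2\<^esup>" "finite V"
  shows "card (covered m) \<le> card V"
  using covered_subset[OF assms(1,2)] assms(3) by (rule card_mono[rotated])

lemma pairing_id: "pairing F id"
  by (simp add: pairing_def)

lemma maximum_pairing_exists:
  assumes "F \<subseteq> [V]\<^bsup>2\<^esup>" "finite V"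
  obtains m where "maximum_pairing F m"
proof -
  have "\<exists>m. pairing F m \<and> (\<forall>m'. pairing F m' \<longrightarrow> card (covered m') \<le> card (covered m))"
    using card_covered_le[OF _ assms] pairing_id
    by (intro ex_has_greatest_nat[where b = "Suc (card V)"]) (auto simp: le_imp_less_Suc)
  then show thesis
    using that by (auto simp: maximum_pairing_def)
qed

lemma pairing_edges:
  assumes "pairing F m"
  shows "pairing_edges m \<subseteq> F" "disjoint (pairing_edges m)" "\<Union>(pairing_edges m) = covered m"
    "\<And>e. e \<in> pairing_edges m \<Longrightarrow> card e = 2"
proof -
  have inv: "m (m v) = v" for v using assms by (simp add: pairing_def)
  show "pairing_edges m \<subseteq> F"
    using assms by (auto simp: pairing_edges_def pairing_def covered_def)
  show "disjoint (pairing_edges m)"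
    unfolding pairing_edges_def
  proof (rule disjointI)
    fix e e' assume *: "e \<in> (\<lambda>v. {v, m v}) ` covered m" "e' \<in> (\<lambda>v. {v, m v}) ` covered m" "e \<noteq> e'"
    have "e = {x, m x}" if "x \<in> e" "e \<in> (\<lambda>v. {v, m v}) ` covered m" for x e
      using that inv by auto
    then have "e = e'" if "x \<in> e" "x \<in> e'" for x
      using that *(1,2) by metis
    then show "e \<inter> e' = {}" using *(3) by blast
  qed
  show "\<Union>(pairing_edges m) = covered m"
  proof (intro equalityI subsetI)
    fix x assume "x \<in> \<Union>(pairing_edges m)"
    then obtain v where v: "m v \<noteq> v" "x = v \<or> x = m v"
      unfolding pairing_edges_def covered_def by blast
    have "m x \<noteq> x" using v inv[of v] by metis
    then show "x \<in> covered m" by (simp add: covered_def)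
  qed (auto simp: pairing_edges_def)
  show "card e = 2" if e: "e \<in> pairing_edges m" for e
  proof -
    obtain v where "m v \<noteq> v" "e = {v, m v}"
      using e unfolding pairing_edges_def covered_def by blast
    then show ?thesis by (metis card_2_iff)
  qed
qed

lemma even_card_covered:
  assumes "pairing F m" "finite (covered m)"
  shows "even (card (covered m))"
proof -
  have "2 dvd card (\<Union>(pairing_edges m))"
    using pairing_edges(3,4)[OF assms(1)] assms(2) disjointD[OF pairing_edges(2)[OF assms(1)]]
    by (intro dvd_partition) auto
  then show ?thesis by (simp only: pairing_edges(3)[OF assms(1)])
qed

text \<open>Dropping edges from a matching that covers at least \<open>n\<close> vertices leaves one
  covering exactly \<open>n\<close>, since \<open>n\<close> is even. So the lack of a matching
  saturating \<open>n\<close> vertices bounds all matchings.\<close>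

lemma matching_of_pairing:
  assumes "pairing F m" "finite (covered m)" "even n" "n \<le> card (covered m)"
  obtains M where "matching F M" "saturates M n"
proof -
  note pe = pairing_edges[OF assms(1)]
  have fin: "finite (pairing_edges m)" using assms(2) by (simp add: pairing_edges_def)
  have "card (covered m) = 2 * card (pairing_edges m)"
    using card_Union_disjoint[of "pairing_edges m"] pe
    by (metis (no_types, lifting) card.infinite mult.commute sum_constant sum.cong numeral_eq_iff
        of_nat_id zero_neq_numeral)
  then obtain M where M: "M \<subseteq> pairing_edges m" "card M = n div 2"
    using assms(4) by (metis div_le_mono nonzero_mult_div_cancel_left obtain_subset_with_card_n
        zero_neq_numeral)
  have dis: "disjoint M" using M(1) pe(2) by (rule pairwise_subset[rotated])
  have c2: "card e = 2" if "e \<in> M" for e using M(1) pe(4) that by blast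
  have "card (\<Union>M) = sum card M"
    using card_Union_disjoint[of M] dis c2 by (metis card.infinite zero_neq_numeral)
  also have "\<dots> = n" using c2 M(2) assms(3) by simp
  finally show thesis
    using that M(1) pe(1) dis by (auto simp: matching_def saturates_def)
qed

text \<open>The witness is the orbit of \<open>y\<close> under \<open>p = n \<circ> m\<close>, that is, the vertex set of the alternating path
  starting at \<open>y\<close>. Since \<open>n\<close> fixes \<open>y\<close>, the point \<open>(p ^^ k) y\<close> is fixed by \<open>m\<close> only
  if \<open>(p ^^ (2 * k + 1)) y = y\<close>; two such \<open>k\<close> agree modulo the period, which is odd.\<close>

lemma alternating_orbit:
  fixes m n :: "'a \<Rightarrow> 'a"
  assumes m: "\<And>v. m (m v) = v" and n: "\<And>v. n (n v) = v" and "finite (covered m)" "finite (covered n)"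
    and y: "n y = y"
  obtains C where "y \<in> C" "\<And>v. m v \<in> C \<longleftrightarrow> v \<in> C" "\<And>v. n v \<in> C \<longleftrightarrow> v \<in> C"
    "\<And>x z. x \<in> C \<Longrightarrow> z \<in> C \<Longrightarrow> m x = x \<Longrightarrow> m z = z \<Longrightarrow> x = z"
proof -
  define p where "p = n \<circ> m"
  define q where "q = m \<circ> n"
  have pq: "p (q v) = v" "q (p v) = v" for v by (simp_all add: p_def q_def m n)
  have injp: "inj p" by (metis injI pq(2))
  have fadd: "(p ^^ (i + j)) v = (p ^^ i) ((p ^^ j) v)" for i j v by (simp add: funpow_add)
  define C where "C = {v. \<exists>k. v = (p ^^ k) y}"
  \<comment> \<open>A point of the orbit moved by neither involution is fixed by \<open>p\<close>;
    as \<open>p ^^ k\<close> is injective, such a point is \<open>y\<close> itself.\<close>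
  have "C \<subseteq> insert y (covered m \<union> covered n)"
  proof
    fix v assume "v \<in> C"
    then obtain k where k: "v = (p ^^ k) y" by (auto simp: C_def)
    show "v \<in> insert y (covered m \<union> covered n)"
    proof (rule ccontr)
      assume "v \<notin> insert y (covered m \<union> covered n)"
      then have nv: "v \<noteq> y" "p v = v" by (auto simp: covered_def p_def)
      then have "(p ^^ k) v = v" by (induction k) auto
      then have "(p ^^ k) v = (p ^^ k) y" using k by simp
      then show False using nv(1) inj_fn[OF injp] by (auto dest: injD)
    qed
  qed
  then have finC: "finite C" using assms(3,4) by (simp add: finite_subset)
  then obtain d where d: "d > 0" "(p ^^ d) y = y"
    using funpow_inj_finite[OF injp] unfolding C_def by blast
  have qk: "(q ^^ k) ((p ^^ k) v) = v" for k v
    by (induction k arbitrary: v) (simp_all add: funpow_swap1 pq)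
  have pk: "(p ^^ (d * k)) y = y" for k
    by (induction k) (simp_all add: d funpow_add)
  \<comment> \<open>\<open>q\<close> is the inverse of \<open>p\<close>, and the period
    \<open>d\<close> turns its powers into nonnegative powers of \<open>p\<close>.\<close>
  have q_in: "(q ^^ k) y \<in> C" for k
  proof -
    have "k \<le> d * k" using d(1) by simp
    then have "(p ^^ (d * k)) y = (p ^^ k) ((p ^^ (d * k - k)) y)"
      by (metis fadd le_add_diff_inverse)
    then have "(q ^^ k) y = (p ^^ (d * k - k)) y" using pk[of k] qk[of k] by metis
    then show ?thesis by (auto simp: C_def)
  qed
  \<comment> \<open>Conjugation by \<open>n\<close> turns \<open>p\<close> into \<open>q\<close>, so
    \<open>n\<close>, which fixes \<open>y\<close>, reflects the orbit; \<open>m\<close> reflects it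
    with a shift by one.\<close>
  have n_p: "n ((p ^^ k) y) = (q ^^ k) y" for k
  proof (induction k)
    case (Suc k)
    have "n ((p ^^ Suc k) y) = m ((p ^^ k) y)" by (simp add: p_def n)
    also have "\<dots> = q (n ((p ^^ k) y))" by (simp add: q_def n)
    finally show ?case using Suc by simp
  qed (simp add: y)
  have m_p: "m ((p ^^ k) y) = (q ^^ Suc k) y" for k
    using n_p[of k] by (simp add: q_def) (metis n)
  have closed: "n v \<in> C" "m v \<in> C" if v: "v \<in> C" for v
  proof -
    obtain k where k: "v = (p ^^ k) y" using v by (auto simp: C_def)
    show "n v \<in> C" "m v \<in> C" using q_in[of k] q_in[of "Suc k"] n_p m_p k by metis+
  qed
  have uniq: "i = j \<or> (p ^^ i) y = (p ^^ j) y"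
    if "m ((p ^^ i) y) = (p ^^ i) y" "m ((p ^^ j) y) = (p ^^ j) y" "i \<le> j" for i j
  proof -
    have per: "(p ^^ (2 * k + 1)) y = y" if "m ((p ^^ k) y) = (p ^^ k) y" for k
    proof -
      have "(q ^^ Suc k) y = (p ^^ k) y" using that m_p by simp
      then have "(p ^^ Suc k) ((p ^^ k) y) = (p ^^ Suc k) ((q ^^ Suc k) y)" by simp
      also have "\<dots> = y"
      proof -
        have "(p ^^ k) ((q ^^ k) v) = v" for k v
          by (induction k arbitrary: v) (simp_all add: funpow_swap1 pq)
        then show ?thesis .
      qed
      finally have "(p ^^ (Suc k + k)) y = y" by (simp only: fadd)
      moreover have "Suc k + k = 2 * k + 1" by simp
      ultimately show ?thesis by metis
    qed
    have mult: "(p ^^ (a * k)) y = y" if "(p ^^ a) y = y" for a k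
      using that by (induction k) (simp_all add: funpow_add)
    define s where "s = j - i"
    have j: "j = i + s" using that(3) by (simp add: s_def)
    have "(p ^^ (2 * i + 1)) y = y" "(p ^^ (2 * j + 1)) y = y" using per that by blast+
    moreover have "2 * j + 1 = 2 * s + (2 * i + 1)" using j by simp
    ultimately have s2: "(p ^^ (2 * s)) y = y"
      by (metis fadd)
    \<comment> \<open>Both \<open>2 * s * i\<close> and \<open>(2 * i + 1) * s\<close> are periods
      at \<open>y\<close>, hence so is their difference \<open>s\<close>.\<close>
    have "(p ^^ s) y = (p ^^ s) ((p ^^ (2 * s * i)) y)" using mult[OF s2] by simp
    also have "\<dots> = (p ^^ (s + 2 * s * i)) y" by (simp only: fadd)
    also have "\<dots> = (p ^^ ((2 * i + 1) * s)) y" by (simp add: algebra_simps)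
    also have "\<dots> = y" using mult per[OF that(1)] by blast
    finally show ?thesis using j by (simp add: funpow_add)
  qed
  show thesis
  proof
    show "y \<in> C" unfolding C_def by (auto intro: exI[of _ 0])
    show "m v \<in> C \<longleftrightarrow> v \<in> C" "n v \<in> C \<longleftrightarrow> v \<in> C" for v
      using closed m n by metis+
    show "x = z" if "x \<in> C" "z \<in> C" "m x = x" "m z = z" for x z
      using that uniq unfolding C_def by (smt (verit, best) mem_Collect_eq nle_le)
  qed
qed

section \<open>Exchange between maximum matchings\<close>

text \<open>Let \<open>m'\<close> follow \<open>n\<close> on the alternating orbit of
  \<open>y\<close> and \<open>m\<close> elsewhere, and \<open>n'\<close> the reverse. Together they
  cover as many vertices as \<open>m\<close> and \<open>n\<close> do, so \<open>m'\<close> is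
  maximum too. The orbit contains at most one vertex missed by \<open>m\<close>, so \<open>x\<close>
  or \<open>z\<close> stays missed.\<close>

lemma maximum_pairing_exchange:
  assumes F: "F \<subseteq> [V]\<^bsup>2\<^esup>" "finite V"
    and m: "maximum_pairing F m" "m x = x" "m z = z" "x \<noteq> z"
    and n: "maximum_pairing F n" "n y = y"
  obtains m' where "maximum_pairing F m'" "m' y = y" "m' x = x \<or> m' z = z"
proof -
  have pm: "pairing F m" and pn: "pairing F n" using m(1) n(1) by (auto simp: maximum_pairing_def)
  then have inv: "m (m v) = v" "n (n v) = v" for v by (auto simp: pairing_def)
  have fin: "finite (covered m)" "finite (covered n)"
    using covered_subset[OF pm F(1)] covered_subset[OF pn F(1)] F(2) by (auto intro: finite_subset)
  obtain C where C: "y \<in> C" "\<And>v. m v \<in> C \<longleftrightarrow> v \<in> C" "\<And>v. n v \<in> C \<longleftrightarrow> v \<in> C"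
    and uniq: "\<And>x z. x \<in> C \<Longrightarrow> z \<in> C \<Longrightarrow> m x = x \<Longrightarrow> m z = z \<Longrightarrow> x = z"
    using alternating_orbit[of m n y] inv fin n(2) by metis
  define m' where "m' = (\<lambda>v. if v \<in> C then n v else m v)"
  define n' where "n' = (\<lambda>v. if v \<in> C then m v else n v)"
  have "pairing F m'" "pairing F n'"
    using pm pn C(2,3) unfolding pairing_def m'_def n'_def by simp_all
  moreover have "card (covered m') + card (covered n') = card (covered m) + card (covered n)"
  proof -
    have split: "card (covered k) = card (covered k \<inter> C) + card (covered k - C)"
      if "finite (covered k)" for k
      using that by (subst card_Un_disjoint[symmetric]) (auto intro: arg_cong[of _ _ card])
    have "covered m' \<inter> C = covered n \<inter> C" "covered m' - C = covered m - C"
      "covered n' \<inter> C = covered m \<inter> C" "covered n' - C = covered n - C"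
      by (auto simp: covered_def m'_def n'_def)
    moreover have "finite (covered m')" "finite (covered n')"
      using fin by (auto intro: finite_subset[of _ "covered m \<union> covered n"]
        simp: covered_def m'_def n'_def split: if_splits)
    ultimately show ?thesis using fin by (simp add: split)
  qed
  ultimately have "maximum_pairing F m'"
    using m(1) n(1) unfolding maximum_pairing_def by (smt (verit) add_le_cancel_right le_antisym nat_le_linear add_le_mono)
  moreover have "m' y = y" using C(1) n(2) by (simp add: m'_def)
  moreover have "x \<notin> C \<or> z \<notin> C" using uniq m(2-4) by blast
  then have "m' x = x \<or> m' z = z" using m(2,3) by (auto simp: m'_def)
  ultimately show thesis using that by blast
qed

lemma pairing_insert_edge:
  assumes "pairing F m" "{x, y} \<in> F" "x \<noteq> y" "m x = x" "m y = y"
  shows "pairing F (m(x := y, y := x))" "covered (m(x := y, y := x)) = insert x (insert y (covered m))"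
proof -
  have "m v \<noteq> x" "m v \<noteq> y" if "v \<noteq> x" "v \<noteq> y" for v
    using assms that by (metis pairing_def)+
  then show "pairing F (m(x := y, y := x))"
    using assms by (auto simp: pairing_def insert_commute)
  show "covered (m(x := y, y := x)) = insert x (insert y (covered m))"
    using assms by (auto simp: covered_def)
qed

text \<open>This is the relation of Gallai's lemma. The case \<open>x = y\<close> makes it reflexive
  also at vertices missed by some maximum pairing.\<close>

definition exclusive :: "'a set set \<Rightarrow> 'a \<Rightarrow> 'a \<Rightarrow> bool" where
  "exclusive F x y \<longleftrightarrow> x = y \<or> (\<forall>m. maximum_pairing F m \<longrightarrow> m x \<noteq> x \<or> m y \<noteq> y)"

text \<open>If a maximum pairing missed \<open>x\<close> and \<open>z\<close>, the exchange with one
  missing \<open>y\<close> would give a maximum pairing that misses \<open>y\<close> together with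
  \<open>x\<close> or \<open>z\<close>.\<close>

lemma exclusive_trans:
  assumes F: "F \<subseteq> [V]\<^bsup>2\<^esup>" "finite V" and y: "maximum_pairing F n" "n y = y"
    and ex: "exclusive F x y" "exclusive F y z"
  shows "exclusive F x z"
proof (rule ccontr)
  assume "\<not> exclusive F x z"
  then obtain m where m: "maximum_pairing F m" "m x = x" "m z = z" "x \<noteq> z"
    by (auto simp: exclusive_def)
  obtain m' where "maximum_pairing F m'" "m' y = y" "m' x = x \<or> m' z = z"
    using maximum_pairing_exchange[OF F m y] .
  then show False using ex m by (auto simp: exclusive_def)
qed

text \<open>A maximum pairing missing both ends of an edge could be enlarged by it.\<close>

lemma exclusive_edge:
  assumes F: "F \<subseteq> [V]\<^bsup>2\<^esup>" "finite V" and "{x, y} \<in> F"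
  shows "exclusive F x y"
proof (rule ccontr)
  assume "\<not> exclusive F x y"
  then obtain m where m: "maximum_pairing F m" "m x = x" "m y = y" "x \<noteq> y"
    by (auto simp: exclusive_def)
  then have pm: "pairing F m" by (simp add: maximum_pairing_def)
  note ins = pairing_insert_edge[OF pm assms(3) m(4,2,3)]
  have "finite (covered m)" using covered_subset[OF pm F(1)] F(2) by (rule finite_subset)
  moreover have "x \<notin> covered m" "y \<notin> covered m" using m by (auto simp: covered_def)
  ultimately have "card (insert x (insert y (covered m))) = Suc (Suc (card (covered m)))"
    using m(4) by simp
  moreover have "card (covered (m(x := y, y := x))) \<le> card (covered m)"
    using m(1) ins(1) by (auto simp: maximum_pairing_def)
  ultimately show False using ins(2) by simp
qed

text \<open>A vertex covered by all maximum pairings can be moved into the barrier \<open>S\<close>. If there is none,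
  \<^const>\<open>exclusive\<close> is an equivalence relation; its classes contain all edges, and a maximum pairing
  misses at most one vertex of each.\<close>

lemma barrier_exists:
  assumes "finite V" "F \<subseteq> [V]\<^bsup>2\<^esup>"
  shows "\<exists>S P m. S \<subseteq> V \<and> partition_on (V - S) P \<and> (\<forall>e\<in>F. e \<inter> S \<noteq> {} \<or> (\<exists>B\<in>P. e \<subseteq> B)) \<and>
    pairing F m \<and> 2 * card S + (\<Sum>B\<in>P. card B - 1) \<le> card (covered m)"
  using assms
proof (induction "card V" arbitrary: V F)
  case 0
  then have "V = {}" "F = {}" by (auto simp: nsets_def)
  then show ?case
    by (intro exI[of _ "{}"] exI[of _ id]) (auto simp: partition_on_def pairing_def)
next
  case (Suc k)
  note F = Suc.prems(2,1)
  show ?case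
  proof (cases "\<exists>v\<in>V. \<forall>m. maximum_pairing F m \<longrightarrow> m v \<noteq> v")
    case True
    then obtain v where v: "v \<in> V" "\<And>m. maximum_pairing F m \<Longrightarrow> m v \<noteq> v" by blast
    define F' where "F' = {e \<in> F. v \<notin> e}"
    have F': "F' \<subseteq> [V - {v}]\<^bsup>2\<^esup>" using F(1) by (auto simp: F'_def nsets_def)
    have "k = card (V - {v})" using Suc.hyps(2) v(1) F(2) by simp
    from Suc.hyps(1)[OF this _ F'] F(2) obtain S P m where
      S: "S \<subseteq> V - {v}" "partition_on (V - {v} - S) P"
        "\<forall>e\<in>F'. e \<inter> S \<noteq> {} \<or> (\<exists>B\<in>P. e \<subseteq> B)"
      and m: "pairing F' m" "2 * card S + (\<Sum>B\<in>P. card B - 1) \<le> card (covered m)" by auto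
    obtain M where M: "maximum_pairing F M" using maximum_pairing_exists[OF F] .
    then have pM: "pairing F M" by (simp add: maximum_pairing_def)
    have pm: "pairing F m" using m(1) by (auto simp: pairing_def F'_def)
    have "m v = v" using covered_subset[OF m(1) F'] by (auto simp: covered_def)
    \<comment> \<open>\<open>m\<close> misses \<open>v\<close>, so it is not maximum in
      \<open>F\<close>. Covered sets have even size, so a maximum pairing covers at least two more
      vertices, which pays for \<open>v\<close> in the barrier.\<close>
    then have "card (covered m) \<noteq> card (covered M)"
      using v(2) M pm by (auto simp: maximum_pairing_def)
    moreover have "card (covered m) \<le> card (covered M)"
      using M pm by (auto simp: maximum_pairing_def)
    moreover have "even (card (covered m))" "even (card (covered M))"
      using even_card_covered[OF pm] even_card_covered[OF pM]
        covered_subset[OF pm F(1)] covered_subset[OF pM F(1)] F(2) by (auto intro: finite_subset)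
    moreover have "a + 2 \<le> b" if "a \<noteq> b" "a \<le> b" "even a" "even b" for a b :: nat
      using that by presburger
    ultimately have "card (covered m) + 2 \<le> card (covered M)" by blast
    moreover have "card (insert v S) = Suc (card S)"
      using S(1) F(2) by (metis Diff_iff card_insert_disjoint finite_Diff finite_subset insertI1 subsetD)
    ultimately have "2 * card (insert v S) + (\<Sum>B\<in>P. card B - 1) \<le> card (covered M)"
      using m(2) by simp
    moreover have "V - insert v S = V - {v} - S" by blast
    moreover have "\<forall>e\<in>F. e \<inter> insert v S \<noteq> {} \<or> (\<exists>B\<in>P. e \<subseteq> B)"
      using S(3) by (auto simp: F'_def)
    ultimately show ?thesis using S(1,2) v(1) pM
      by (intro exI[of _ "insert v S"] exI[of _ P] exI[of _ M]) auto
  next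
    case False
    then have ines: "\<exists>m. maximum_pairing F m \<and> m v = v" if "v \<in> V" for v using that by blast
    define r where "r = {(x, y). x \<in> V \<and> y \<in> V \<and> exclusive F x y}"
    have "equiv V r"
    proof (rule equivI)
      show "r \<subseteq> V \<times> V" "refl_on V r" by (auto simp: r_def refl_on_def exclusive_def)
      show "sym r" by (auto simp: r_def sym_def exclusive_def)
      show "trans r"
      proof (rule transI)
        fix x y z assume "(x, y) \<in> r" "(y, z) \<in> r"
        then show "(x, z) \<in> r" using exclusive_trans[OF F] ines[of y] unfolding r_def by blast
      qed
    qed
    then have part: "partition_on V (V // r)" by (rule partition_on_quotient)
    obtain m where m: "maximum_pairing F m" using maximum_pairing_exists[OF F] .
    then have pm: "pairing F m" by (simp add: maximum_pairing_def)
    have finP: "finite (V // r)" using finite_elements[OF F(2) part] .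
    have block: "card B - 1 \<le> card (B \<inter> covered m)" if B: "B \<in> V // r" for B
    proof -
      have finB: "finite B" using B part F(2) by (metis partition_onD1 Union_upper finite_subset)
      have "x = y" if "x \<in> B - covered m" "y \<in> B - covered m" for x y
      proof -
        have "(x, y) \<in> r" using quotient_eq_iff[OF \<open>equiv V r\<close> B B] that by blast
        then show ?thesis using that m by (auto simp: r_def exclusive_def covered_def)
      qed
      then have "card (B - covered m) \<le> 1" using finB by (simp add: card_le_Suc0_iff_eq)
      moreover have "card B = card (B \<inter> covered m) + card (B - covered m)"
        using finB by (subst card_Un_disjoint[symmetric]) (auto intro: arg_cong[of _ _ card])
      ultimately show ?thesis by simp
    qed
    have "(\<Sum>B\<in>V // r. card B - 1) \<le> (\<Sum>B\<in>V // r. card (B \<inter> covered m))"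
      using block by (rule sum_mono)
    also have "\<dots> = card (\<Union>B\<in>V // r. B \<inter> covered m)"
      using finP part F(2)
      by (intro card_UN_disjoint[symmetric])
        (auto dest: partition_onD2 partition_onD1 disjointD intro: finite_subset)
    also have "(\<Union>B\<in>V // r. B \<inter> covered m) = covered m"
      using partition_onD1[OF part] covered_subset[OF pm F(1)] by blast
    finally have "2 * card ({} :: 'a set) + (\<Sum>B\<in>V // r. card B - 1) \<le> card (covered m)" by simp
    moreover have "\<exists>B\<in>V // r. e \<subseteq> B" if e: "e \<in> F" for e
    proof -
      obtain x y where xy: "e = {x, y}" "x \<in> V" "y \<in> V"
        using F(1) e by (auto simp: nsets_def card_2_iff)
      then have "(x, y) \<in> r" using exclusive_edge[OF F] e by (auto simp: r_def)
      then have "e \<subseteq> r `` {x}" using xy by (auto simp: r_def exclusive_def)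
      then show ?thesis using xy(2) by (auto intro: quotientI)
    qed
    ultimately show ?thesis using part pm
      by (intro exI[of _ "{}"] exI[of _ "V // r"] exI[of _ m]) auto
  qed
qed

section \<open>The finite system of states\<close>

text \<open>The state of a vertex in a colour. If the colour has a component on more than \<open>N\<close> vertices
  (flag \<^const>\<open>True\<close>), the states \<open>Z\<close>, \<open>H\<close>, \<open>W\<close> are the weights \<open>0\<close>, \<open>1/2\<close>, \<open>1\<close> in it, and \<open>X\<close> stands for
  the other vertices. Otherwise \<open>Z\<close>, \<open>H\<close>, \<open>W\<close> are arbitrary names of three unions of components,
  each on at most \<open>N\<close> vertices, and \<open>X\<close> does not occur.\<close>

datatype state = Z | H | W | X

type_synonym box = "state list \<times> state list \<times> state list"

text \<open>Linked states are those that the ends of an edge of the colour can have, up to the few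
  exceptional edges: total weight at least \<open>1\<close> in the large component, both ends
  outside it, or both in the same union.\<close>

fun link :: "bool \<Rightarrow> state \<Rightarrow> state \<Rightarrow> bool" where
  "link True Z b = (b = W)"
| "link True H b = (b = H \<or> b = W)"
| "link True W b = (b \<noteq> X)"
| "link True X b = (b = X)"
| "link False a b = (a = b)"

text \<open>Nonnegative multipliers \<open>(p, q, r)\<close> of the size bounds of one colour. The total cost of all
  vertices is at most \<open>N\<close> times the budget.\<close>

fun cost :: "bool \<Rightarrow> int \<times> int \<times> int \<Rightarrow> state \<Rightarrow> int" where
  "cost True (p, q, r) s = (case s of Z \<Rightarrow> 0 | H \<Rightarrow> p | W \<Rightarrow> 2 * p | X \<Rightarrow> q)"
| "cost False (p, q, r) s = (case s of Z \<Rightarrow> p | H \<Rightarrow> q | W \<Rightarrow> r | X \<Rightarrow> 0)"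

fun budget :: "int \<times> int \<times> int \<Rightarrow> int" where
  "budget (p, q, r) = p + q + r"

fun nonneg :: "int \<times> int \<times> int \<Rightarrow> bool" where
  "nonneg (p, q, r) \<longleftrightarrow> 0 \<le> p \<and> 0 \<le> q \<and> 0 \<le> r"

fun in_box :: "state \<times> state \<times> state \<Rightarrow> box \<Rightarrow> bool" where
  "in_box (a, b, c) (A, B, C) \<longleftrightarrow> a \<in> set A \<and> b \<in> set B \<and> c \<in> set C"

text \<open>Of the chosen vertex only the box is known, so the test covers all of it: whichever
  triple that vertex has, \<open>(a, b, c)\<close> is not linked to it in any colour.\<close>

fun avoids :: "bool \<times> bool \<times> bool \<Rightarrow> state \<times> state \<times> state \<Rightarrow> box \<Rightarrow> bool" where
  "avoids (k, l, m) (a, b, c) (A, B, C) \<longleftrightarrow>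
     list_all (\<lambda>s. \<not> link k s a) A \<and> list_all (\<lambda>s. \<not> link l s b) B \<and> list_all (\<lambda>s. \<not> link m s c) C"

fun picked_cost :: "bool \<times> bool \<times> bool \<Rightarrow> state \<times> state \<times> state \<Rightarrow> box list \<Rightarrow> int list \<Rightarrow> int" where
  "picked_cost md t (G # Gs) (y # ys) =
     (if y = 0 then picked_cost md t Gs ys
      else if avoids md t G then y + picked_cost md t Gs ys else picked_cost md t Gs ys)"
| "picked_cost md t _ _ = 0"

datatype coord = Fst | Snd | Trd

fun restrict :: "coord \<Rightarrow> (state \<Rightarrow> bool) \<Rightarrow> box \<Rightarrow> box" where
  "restrict Fst P (A, B, C) = (filter P A, B, C)"
| "restrict Snd P (A, B, C) = (A, filter P B, C)"
| "restrict Trd P (A, B, C) = (A, B, filter P C)"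

text \<open>\<open>Pick\<close> branches on whether a triple of the box occurs at all.
  \<open>Split\<close> narrows the box of a vertex already chosen, so that more triples avoid it.
  \<open>Vacuous\<close> closes a branch whose chosen vertex could only have an excluded
  triple.\<close>

datatype cert =
  Leaf int "(int \<times> int \<times> int) \<times> (int \<times> int \<times> int) \<times> (int \<times> int \<times> int)" "int list"
| Pick box cert cert
| Split nat coord "state list" cert cert
| Vacuous nat

definition cells :: "box \<Rightarrow> (state \<times> state \<times> state) list" where
  "cells = (\<lambda>(A, B, C). List.product A (List.product B C))"

text \<open>In \<open>check md Gs Ds t\<close> each box in \<open>Gs\<close> is known to contain the state triple of some vertex, and no
  state triple lies in a box in \<open>Ds\<close>. A leaf is a solution of the dual linear program, with common
  denominator \<open>d\<close>: multipliers of the size bounds and, in \<open>ys\<close>, of the bounds \<open>N/4\<close> on the number of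
  vertices not linked to the vertices chosen in \<open>Gs\<close>. Every possible state triple receives cost at
  least \<open>d\<close>, so there are at most \<open>2 * N\<close> vertices.\<close>

fun check :: "bool \<times> bool \<times> bool \<Rightarrow> box list \<Rightarrow> box list \<Rightarrow> cert \<Rightarrow> bool" where
  "check (k, l, m) Gs Ds (Leaf d (p, q, r) ys) \<longleftrightarrow>
     0 < d \<and> nonneg p \<and> nonneg q \<and> nonneg r \<and> list_all (\<lambda>y. 0 \<le> y) ys \<and>
     4 * (budget p + budget q + budget r) + sum_list ys \<le> 8 * d \<and>
     list_all (\<lambda>a. list_all (\<lambda>b. list_all (\<lambda>c.
         if d \<le> cost k p a + cost l q b + cost m r c + picked_cost (k, l, m) (a, b, c) Gs ys then True
         else list_ex (in_box (a, b, c)) Ds)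
       [Z, H, W, X]) [Z, H, W, X]) [Z, H, W, X]"
| "check md Gs Ds (Pick G s t) \<longleftrightarrow> check md (Gs @ [G]) Ds s \<and> check md Gs (G # Ds) t"
| "check md Gs Ds (Split i c S s t) \<longleftrightarrow> i < length Gs \<and>
     check md (Gs[i := restrict c (\<lambda>x. x \<in> set S) (Gs ! i)]) Ds s \<and>
     check md (Gs[i := restrict c (\<lambda>x. x \<notin> set S) (Gs ! i)]) Ds t"
| "check md Gs Ds (Vacuous i) \<longleftrightarrow> i < length Gs \<and> list_all (\<lambda>t. list_ex (in_box t) Ds) (cells (Gs ! i))"


section \<open>The system of inequalities and the soundness of certificates\<close>

definition bounded_states :: "bool \<Rightarrow> 'a set \<Rightarrow> nat \<Rightarrow> ('a \<Rightarrow> state) \<Rightarrow> bool" where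
  "bounded_states big V N f \<longleftrightarrow>
     (if big then card (V \<inter> {v. f v = H}) + 2 * card (V \<inter> {v. f v = W}) \<le> N \<and> card (V \<inter> {v. f v = X}) \<le> N
      else (\<forall>s. card (V \<inter> {v. f v = s}) \<le> N) \<and> (\<forall>v\<in>V. f v \<noteq> X))"

text \<open>The vertex \<open>u\<close> counts among those unlinked to it if its triple is not
  linked to itself, such as \<open>Z\<close> in three colours with flag \<open>True\<close>.\<close>

definition config ::
  "bool \<Rightarrow> bool \<Rightarrow> bool \<Rightarrow> 'a set \<Rightarrow> nat \<Rightarrow> ('a \<Rightarrow> state) \<Rightarrow> ('a \<Rightarrow> state) \<Rightarrow> ('a \<Rightarrow> state) \<Rightarrow> bool" where
  "config k l m V N f g h \<longleftrightarrow> finite V \<and>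
     bounded_states k V N f \<and> bounded_states l V N g \<and> bounded_states m V N h \<and>
     (\<forall>u\<in>V. 4 * card {v \<in> V. \<not> (link k (f u) (f v) \<or> link l (g u) (g v) \<or> link m (h u) (h v))} \<le> N)"

lemma sum_cost_le:
  assumes "finite V" "bounded_states k V N f" "nonneg z"
  shows "(\<Sum>v\<in>V. cost k z (f v)) \<le> budget z * int N"
proof -
  obtain p q r where z: "z = (p, q, r)" by (cases z)
  let ?n = "\<lambda>s. int (card (V \<inter> {v. f v = s}))"
  have pqr: "0 \<le> p" "0 \<le> q" "0 \<le> r" using assms(3) z by simp_all
  show ?thesis
  proof (cases k)
    case True
    have "cost k z (f v) = p * of_bool (f v = H) + 2 * p * of_bool (f v = W) + q * of_bool (f v = X)" for v
      by (simp add: True z split: state.split)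
    then have "(\<Sum>v\<in>V. cost k z (f v)) = p * (?n H + 2 * ?n W) + q * ?n X"
      using assms(1) by (simp add: sum.distrib sum_distrib_left[symmetric] algebra_simps)
    also have "\<dots> \<le> p * int N + q * int N"
      using assms(2) True pqr unfolding bounded_states_def
      by (intro add_mono mult_left_mono) auto
    also have "\<dots> \<le> budget z * int N" using pqr by (simp add: z algebra_simps)
    finally show ?thesis .
  next
    case False
    have "cost k z (f v) = p * of_bool (f v = Z) + q * of_bool (f v = H) + r * of_bool (f v = W)" for v
      by (simp add: False z split: state.split)
    then have "(\<Sum>v\<in>V. cost k z (f v)) = p * ?n Z + q * ?n H + r * ?n W"
      using assms(1) by (simp add: sum.distrib sum_distrib_left[symmetric])
    also have "\<dots> \<le> p * int N + q * int N + r * int N"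
      using assms(2) False pqr unfolding bounded_states_def
      by (intro add_mono mult_left_mono) auto
    finally show ?thesis by (simp add: z algebra_simps)
  qed
qed

text \<open>All vertices charged for a box are unlinked to one fixed vertex whose triple lies in the
  box, and there are at most \<open>N/4\<close> of them.\<close>

lemma sum_picked_cost_le:
  assumes "config k l m V N f g h" "\<forall>G\<in>set Gs. \<exists>v\<in>V. in_box (f v, g v, h v) G" "\<forall>y\<in>set ys. 0 \<le> y"
  shows "4 * (\<Sum>v\<in>V. picked_cost (k, l, m) (f v, g v, h v) Gs ys) \<le> sum_list ys * int N"
  using assms(2,3)
proof (induction Gs ys rule: list_induct2')
  case (4 G Gs y ys)
  obtain A B C where G: "G = (A, B, C)" by (cases G)
  obtain u where u: "u \<in> V" "in_box (f u, g u, h u) G" using "4.prems"(1) by auto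
  define S where "S = {v \<in> V. \<not> (link k (f u) (f v) \<or> link l (g u) (g v) \<or> link m (h u) (h v))}"
  have VS: "V \<inter> S = S" by (auto simp: S_def)
  have fin: "finite V" using assms(1) by (simp add: config_def)
  have "picked_cost (k, l, m) (f v, g v, h v) (G # Gs) (y # ys)
      \<le> y * of_bool (v \<in> S) + picked_cost (k, l, m) (f v, g v, h v) Gs ys" if "v \<in> V" for v
    using that u "4.prems"(2) by (auto simp: G S_def list_all_iff)
  then have "(\<Sum>v\<in>V. picked_cost (k, l, m) (f v, g v, h v) (G # Gs) (y # ys))
      \<le> (\<Sum>v\<in>V. y * of_bool (v \<in> S) + picked_cost (k, l, m) (f v, g v, h v) Gs ys)"
    by (rule sum_mono)
  also have "\<dots> = y * int (card S) + (\<Sum>v\<in>V. picked_cost (k, l, m) (f v, g v, h v) Gs ys)"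
    using fin by (simp add: VS sum.distrib sum_distrib_left[symmetric])
  finally have "4 * (\<Sum>v\<in>V. picked_cost (k, l, m) (f v, g v, h v) (G # Gs) (y # ys))
      \<le> y * (4 * int (card S)) + 4 * (\<Sum>v\<in>V. picked_cost (k, l, m) (f v, g v, h v) Gs ys)"
    by simp
  also have "y * (4 * int (card S)) \<le> y * int N"
  proof (rule mult_left_mono)
    have "4 * card S \<le> N" using assms(1) u(1) by (simp add: config_def S_def)
    then show "4 * int (card S) \<le> int N" by linarith
  qed (use "4.prems"(2) in simp)
  also have "4 * (\<Sum>v\<in>V. picked_cost (k, l, m) (f v, g v, h v) Gs ys) \<le> sum_list ys * int N"
    using "4.IH" "4.prems" by simp
  finally show ?case by (simp add: algebra_simps)
qed (auto intro!: mult_nonneg_nonneg add_nonneg_nonneg sum_list_nonneg)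

lemma in_states: "s \<in> set [Z, H, W, X]"
  by (cases s) simp_all

lemma in_box_restrict:
  "in_box t (restrict c P G) \<longleftrightarrow> in_box t G \<and> P (case (c, t) of (Fst, a, b, d) \<Rightarrow> a | (Snd, a, b, d) \<Rightarrow> b | (Trd, a, b, d) \<Rightarrow> d)"
  by (cases c; cases t; cases G) (auto simp:)

text \<open>A leaf is weak duality: every vertex costs at least \<open>d\<close>, and all together
  cost at most \<open>2 * d * N\<close>. Inner nodes are case distinctions that keep the assumptions
  on \<open>Gs\<close> and \<open>Ds\<close> true.\<close>

lemma check_sound:
  assumes "check (k, l, m) Gs Ds t" "config k l m V N f g h"
    and "\<forall>G\<in>set Gs. \<exists>v\<in>V. in_box (f v, g v, h v) G" "\<forall>D\<in>set Ds. \<forall>v\<in>V. \<not> in_box (f v, g v, h v) D"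
  shows "card V \<le> 2 * N"
  using assms(1,3,4)
proof (induction t arbitrary: Gs Ds)
  case (Leaf d z ys)
  obtain p q r where z: "z = (p, q, r)" by (cases z)
  note ch = Leaf.prems(1)[unfolded z, simplified check.simps]
  have fin: "finite V" and bd: "bounded_states k V N f" "bounded_states l V N g" "bounded_states m V N h"
    using assms(2) by (auto simp: config_def)
  have d: "0 < d" "nonneg p" "nonneg q" "nonneg r" "\<forall>y\<in>set ys. 0 \<le> y"
    "4 * (budget p + budget q + budget r) + sum_list ys \<le> 8 * d"
    using ch by (auto simp: list_all_iff)
  have "d \<le> cost k p (f v) + cost l q (g v) + cost m r (h v) + picked_cost (k, l, m) (f v, g v, h v) Gs ys"
    if "v \<in> V" for v
  proof -
    have "\<not> list_ex (in_box (f v, g v, h v)) Ds" using Leaf.prems(3) that by (auto simp: list_ex_iff)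
    then show ?thesis
      using ch in_states[of "f v"] in_states[of "g v"] in_states[of "h v"]
      unfolding list_all_iff by (metis (no_types, lifting))
  qed
  then have "(\<Sum>v\<in>V. d) \<le> (\<Sum>v\<in>V. cost k p (f v) + cost l q (g v) + cost m r (h v) + picked_cost (k, l, m) (f v, g v, h v) Gs ys)"
    by (rule sum_mono)
  then have "4 * (d * int (card V)) \<le> 4 * (\<Sum>v\<in>V. cost k p (f v)) + 4 * (\<Sum>v\<in>V. cost l q (g v))
      + 4 * (\<Sum>v\<in>V. cost m r (h v)) + 4 * (\<Sum>v\<in>V. picked_cost (k, l, m) (f v, g v, h v) Gs ys)"
    by (simp add: sum.distrib mult.commute)
  also have "\<dots> \<le> 4 * (budget p * int N) + 4 * (budget q * int N) + 4 * (budget r * int N) + sum_list ys * int N"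
    using sum_cost_le[OF fin bd(1) d(2)] sum_cost_le[OF fin bd(2) d(3)] sum_cost_le[OF fin bd(3) d(4)]
      sum_picked_cost_le[OF assms(2) Leaf.prems(2) d(5)] by linarith
  also have "\<dots> = (4 * (budget p + budget q + budget r) + sum_list ys) * int N"
    by (simp add: algebra_simps)
  also have "\<dots> \<le> 8 * d * int N" using d(6) by (rule mult_right_mono) simp
  finally have "d * int (card V) \<le> d * (2 * int N)" by simp
  then have "int (card V) \<le> 2 * int N" using d(1) by simp
  then show ?case by linarith
next
  case (Pick G s t)
  show ?case
  proof (cases "\<exists>v\<in>V. in_box (f v, g v, h v) G")
    case True
    then show ?thesis using Pick.prems by (intro Pick.IH(1)[of "Gs @ [G]" Ds]) auto
  next
    case False
    then show ?thesis using Pick.prems by (intro Pick.IH(2)[of Gs "G # Ds"]) auto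
  qed
next
  case (Split i c S s t)
  then have i: "i < length Gs" by simp
  then obtain v where v: "v \<in> V" "in_box (f v, g v, h v) (Gs ! i)"
    using Split.prems(2) nth_mem by blast
  have upd: "\<forall>G\<in>set (Gs[i := restrict c P (Gs ! i)]). \<exists>v\<in>V. in_box (f v, g v, h v) G"
    if "in_box (f v, g v, h v) (restrict c P (Gs ! i))" for P
    using that v(1) Split.prems(2) set_update_subset_insert[of Gs i] by blast
  show ?case
  proof (cases "in_box (f v, g v, h v) (restrict c (\<lambda>x. x \<in> set S) (Gs ! i))")
    case True
    then show ?thesis using Split.prems by (intro Split.IH(1)[OF _ upd[OF True]]) auto
  next
    case False
    then have *: "in_box (f v, g v, h v) (restrict c (\<lambda>x. x \<notin> set S) (Gs ! i))"
      using v(2) by (simp add: in_box_restrict)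
    show ?thesis using Split.prems by (intro Split.IH(2)[OF _ upd[OF *]]) auto
  qed
next
  case (Vacuous i)
  then have i: "i < length Gs" by simp
  then obtain v where v: "v \<in> V" "in_box (f v, g v, h v) (Gs ! i)"
    using Vacuous.prems(2) nth_mem by blast
  then have "(f v, g v, h v) \<in> set (cells (Gs ! i))"
    by (cases "Gs ! i") (auto simp: cells_def)
  then have "list_ex (in_box (f v, g v, h v)) Ds" using Vacuous.prems(1) by (auto simp: list_all_iff)
  then show ?case using Vacuous.prems(3) v(1) by (auto simp: list_ex_iff)
qed


section \<open>Symmetries and forbidden boxes\<close>

lemma config_swap12: "config k l m V N f g h \<Longrightarrow> config l k m V N g f h"
  by (simp add: config_def disj_left_commute)

lemma config_swap23: "config k l m V N f g h \<Longrightarrow> config k m l V N f h g"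
  by (simp add: config_def disj_commute)

text \<open>A forbidden box contains no triple of any counterexample, so it may be passed as an
  element of \<open>Ds\<close> to later checks. The argument \<open>T\<close> fixes the vertex type
  over which \<open>V\<close> is quantified.\<close>

definition forbidden :: "'a itself \<Rightarrow> bool \<Rightarrow> bool \<Rightarrow> bool \<Rightarrow> box \<Rightarrow> bool" where
  "forbidden T k l m G \<longleftrightarrow> (\<forall>(V :: 'a set) N f g h.
     config k l m V N f g h \<longrightarrow> 2 * N < card V \<longrightarrow> (\<forall>v\<in>V. \<not> in_box (f v, g v, h v) G))"

lemma forbidden_if_check:
  assumes "check (k, l, m) [G] Ds t" "list_all (forbidden T k l m) Ds"
  shows "forbidden T k l m G"
  unfolding forbidden_def
proof (intro allI impI ballI notI)
  fix V :: "'a set" and N f g h v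
  assume *: "config k l m V N f g h" "2 * N < card V" "v \<in> V" "in_box (f v, g v, h v) G"
  then have "card V \<le> 2 * N"
    using assms(2) by (intro check_sound[OF assms(1) *(1)]) (auto simp: list_all_iff forbidden_def)
  then show False using *(2) by simp
qed

lemma card_le_if_check:
  fixes V :: "'a set"
  assumes "check (k, l, m) [] Ds t" "list_all (forbidden TYPE('a) k l m) Ds" "config k l m V N f g h"
  shows "card V \<le> 2 * N"
proof (rule ccontr)
  assume "\<not> card V \<le> 2 * N"
  then have "card V \<le> 2 * N"
    using assms(2,3) by (intro check_sound[OF assms(1,3)]) (auto simp: list_all_iff forbidden_def)
  then show False using \<open>\<not> card V \<le> 2 * N\<close> by simp
qed

lemma forbidden_swap12:
  assumes "forbidden T k l m (A, B, C)" shows "forbidden T l k m (B, A, C)"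
  using assms config_swap12 unfolding forbidden_def in_box.simps by blast

lemma forbidden_swap23:
  assumes "forbidden T k l m (A, B, C)" shows "forbidden T k m l (A, C, B)"
  using assms config_swap23 unfolding forbidden_def in_box.simps by blast

lemma forbidden_permute:
  assumes "forbidden T k k k (A, B, C)"
  shows "forbidden T k k k (A, C, B)" "forbidden T k k k (B, A, C)" "forbidden T k k k (B, C, A)"
    "forbidden T k k k (C, A, B)" "forbidden T k k k (C, B, A)"
  using assms by (blast intro: forbidden_swap12 forbidden_swap23)+

lemma forbidden_X3: "forbidden T k l False (A, B, [X])"
  by (auto simp: forbidden_def config_def bounded_states_def)

lemma forbidden_X2: "forbidden T k False m (A, [X], C)"
  by (intro forbidden_swap23[OF forbidden_X3])

lemma forbidden_X1: "forbidden T False l m ([X], B, C)"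
  by (intro forbidden_swap12[OF forbidden_X2])

text \<open>The names of the three unions of components are interchangeable.\<close>

lemma forbidden_relabel:
  assumes "forbidden T k l False (A, B, [Z])"
  shows "forbidden T k l False (A, B, [Z, H, W])"
  unfolding forbidden_def
proof (intro allI impI ballI notI)
  fix V :: "'a set" and N f g h v
  assume *: "config k l False V N f g h" "2 * N < card V" "v \<in> V" "in_box (f v, g v, h v) (A, B, [Z, H, W])"
  \<comment> \<open>\<open>p\<close> is the transposition of \<open>h v\<close> and
    \<open>Z\<close>. It fixes \<open>X\<close>, because \<open>h v\<close> is one of
    \<open>Z\<close>, \<open>H\<close>, \<open>W\<close>.\<close>
  define p where "p s = (if s = h v then Z else if s = Z then h v else s)" for s
  have p: "p (p s) = s" "p s = p s' \<longleftrightarrow> s = s'" "p X = X" "p (h v) = Z" for s s'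
    using *(4) by (auto simp: p_def)
  have "V \<inter> {u. p (h u) = s} = V \<inter> {u. h u = p s}" for s using p(1) by auto
  moreover have "p (h u) \<noteq> X" if "u \<in> V" for u
    using *(1) p(2,3) that by (metis config_def bounded_states_def)
  ultimately have "bounded_states False V N (\<lambda>u. p (h u))"
    using *(1) by (simp add: config_def bounded_states_def)
  then have "config k l False V N f g (\<lambda>u. p (h u))"
    using *(1) p(2) by (simp add: config_def)
  moreover have "in_box (f v, g v, p (h v)) (A, B, [Z])" using *(4) p(4) by simp
  ultimately show False using assms *(2,3) unfolding forbidden_def by blast
qed

section \<open>Excluded triples for each pattern of flags\<close>

context
  fixes T :: "'a itself"
begin

text \<open>In the names, \<open>b\<close> marks a colour with a component on more than
  \<open>N\<close> vertices, \<open>g\<close> one whose components are grouped. Only triples with a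
  \<open>W\<close> are linked to \<open>(Z, Z, Z)\<close>: they cost at least \<open>2\<close> by
  their weights, and all others get \<open>2\<close> from the chosen vertex. The total
  \<open>4 * 3 + 2\<close> is below \<open>8 * 2\<close>.\<close>

lemma forbidden_bbb_ZZZ: "forbidden T True True True ([Z], [Z], [Z])"
  by (rule forbidden_if_check[where Ds = "[]" and t = "
    Leaf 2 ((1,0,0),(1,0,0),(1,0,0)) [2]"],
    code_simp, simp)

text \<open>From here on the earlier exclusions, with their permutations, enter as
  \<open>Ds\<close>, so leaves need no cost for those triples.\<close>

lemma forbidden_bbb_HZZ: "forbidden T True True True ([H], [Z], [Z])"
  by (rule forbidden_if_check[where Ds = "[([Z],[Z],[Z])]" and t = "
    Pick ([X],[Z],[Z]) (Leaf 2 ((0,0,0),(1,0,0),(1,0,0)) [2,2]) (Pick ([Z,H],[X],[Z]) (Leaf 2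
    ((2,0,0),(0,0,0),(1,0,0)) [2,2]) (Pick ([Z,X],[Z,H,X],[Z,H,X]) (Pick ([H],[Z],[X]) (Leaf 2
    ((2,0,0),(1,0,0),(0,0,0)) [2,0,2]) (Pick ([Z,X],[Z,H,W],[Z,H,W]) (Leaf 2
    ((1,0,0),(1,0,0),(1,0,0)) [2,1,1]) (Pick ([Z,X],[Z,X],[Z,X]) (Pick ([X],[X],[Z]) (Leaf 3
    ((1,0,0),(1,1,0),(1,1,0)) [2,1,0,1]) (Leaf 4 ((2,0,0),(1,0,0),(2,2,0)) [2,1,1])) (Leaf 5
    ((3,0,0),(2,1,0),(2,1,0)) [2,2])))) (Leaf 2 ((2,0,0),(1,0,0),(1,0,0)) [0])))"],
    code_simp, simp add: forbidden_bbb_ZZZ forbidden_permute[OF forbidden_bbb_ZZZ])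

lemma forbidden_bbb_XZZ: "forbidden T True True True ([X], [Z], [Z])"
  by (rule forbidden_if_check[where Ds = "[([Z],[Z],[Z]), ([H],[Z],[Z]), ([Z],[H],[Z]), ([Z],[Z],[H])]" and t = "
    Pick ([W],[Z],[Z]) (Leaf 2 ((0,0,0),(1,0,0),(1,0,0)) [2,2]) (Pick ([Z,H,W],[Z,H,X],[Z,H,X])
    (Pick ([Z,H,W],[W],[Z,X]) (Pick ([X],[Z],[X]) (Leaf 2 ((0,2,0),(1,0,0),(0,0,0)) [2,0,0,2])
    (Pick ([X],[X],[X]) (Pick ([X],[X],[Z]) (Leaf 2 ((0,2,0),(0,0,0),(1,0,0)) [2,0,0,0,2]) (Pick
    ([Z,H,W],[Z,H,W],[Z,H,W]) (Leaf 2 ((0,1,0),(1,0,0),(1,0,0)) [2,1,0,0,1]) (Pick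
    ([Z,H,W],[Z,X],[Z,X]) (Leaf 3 ((0,1,0),(1,1,0),(1,1,0)) [2,1,0,0,1]) (Leaf 5
    ((0,3,0),(2,1,0),(2,1,0)) [2,2,0,0])))) (Leaf 2 ((0,1,0),(1,0,0),(1,0,0)) [2,1,1]))) (Leaf 4
    ((0,4,0),(1,0,0),(2,0,0)) [4,0])) (Leaf 2 ((0,2,0),(1,0,0),(1,0,0)) [0]))"],
    code_simp, simp add: forbidden_bbb_ZZZ forbidden_permute[OF forbidden_bbb_ZZZ] forbidden_bbb_HZZ forbidden_permute[OF forbidden_bbb_HZZ])

lemma forbidden_bbb_WZZ: "forbidden T True True True ([W], [Z], [Z])"
  by (rule forbidden_if_check[where Ds = "[([Z],[Z],[Z]), ([H],[Z],[Z]), ([Z],[H],[Z]), ([Z],[Z],[H]), ([X],[Z],[Z]), ([Z],[X],[Z]), ([Z],[Z],[X])]" and t = "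
    Pick ([Z,H],[X],[Z,H,X]) (Pick ([Z,H,X],[Z,X],[Z,H]) (Pick ([Z],[H],[H]) (Pick ([Z],[X],[H])
    (Leaf 2 ((1,0,0),(0,0,0),(2,0,0)) [0,0,0,2,2]) (Leaf 2 ((1,0,0),(1,0,0),(1,0,0)) [1,0,1,2]))
    (Pick ([Z],[X],[H,X]) (Pick ([Z,H,X],[X],[Z,H]) (Pick ([Z],[X],[H]) (Pick ([Z],[X],[X])
    (Leaf 2 ((1,0,0),(0,2,0),(0,0,0)) [0,0,0,0,0,2,2]) (Pick ([Z],[H],[X]) (Split 3 Trd [H]
    (Leaf 6 ((3,0,0),(2,2,0),(2,1,0)) [3,0,0,3,0,0,2]) (Vacuous 3)) (Split 3 Trd [H] (Leaf 4
    ((2,0,0),(1,2,0),(2,0,0)) [2,0,0,2,0,0]) (Vacuous 3)))) (Pick ([Z],[H,W],[X]) (Split 2 Fst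
    [H,X] (Split 3 Trd [X] (Leaf 2 ((1,0,0),(0,0,0),(0,2,0)) [0,0,0,2,0,2]) (Vacuous 3))
    (Vacuous 2)) (Pick ([Z],[X],[W]) (Split 2 Fst [H,X] (Split 3 Trd [X] (Leaf 2
    ((1,0,0),(0,2,0),(0,0,0)) [0,0,0,2,0,2]) (Vacuous 3)) (Vacuous 2)) (Pick
    ([Z,H,X],[Z,H,W],[Z,H,W]) (Pick ([H],[X],[Z,H]) (Pick ([H],[Z,H],[X]) (Split 2 Fst [H,X]
    (Split 3 Trd [X] (Leaf 2 ((1,0,0),(0,1,0),(0,1,0)) [0,0,0,2,0,0,1,1]) (Vacuous 3)) (Vacuous
    2)) (Split 2 Fst [H,X] (Split 3 Trd [X] (Leaf 4 ((2,0,0),(1,2,0),(1,0,0)) [2,0,0,2,0,2,2])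
    (Vacuous 3)) (Vacuous 2))) (Pick ([Z],[Z,H],[W]) (Split 1 Trd [X] (Split 2 Fst [H,X] (Split
    3 Trd [X] (Split 4 Fst [X] (Leaf 6 ((2,0,0),(3,2,0),(2,0,0)) [4,0,0,2,2,2,2]) (Vacuous 4))
    (Vacuous 3)) (Vacuous 2)) (Vacuous 1)) (Pick ([X],[X],[Z]) (Split 1 Trd [X] (Split 2 Fst
    [H,X] (Split 3 Trd [X] (Split 4 Fst [X] (Leaf 6 ((2,2,0),(1,2,0),(1,2,0)) [2,0,0,2,1,2,1])
    (Vacuous 4)) (Vacuous 3)) (Vacuous 2)) (Vacuous 1)) (Pick ([X],[Z],[X]) (Split 1 Trd [X]
    (Split 2 Fst [H,X] (Split 2 Trd [H] (Split 3 Trd [X] (Split 4 Fst [X] (Leaf 8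
    ((2,2,0),(1,2,0),(2,4,0)) [2,0,0,4,2,2,2]) (Vacuous 4)) (Vacuous 3)) (Vacuous 2)) (Vacuous
    2)) (Vacuous 1)) (Split 1 Trd [X] (Split 2 Fst [H,X] (Split 2 Trd [H] (Split 3 Trd [X]
    (Split 4 Fst [X] (Leaf 16 ((6,4,0),(3,4,0),(4,6,0)) [4,0,0,6,4,6]) (Vacuous 4)) (Vacuous 3))
    (Vacuous 2)) (Vacuous 2)) (Vacuous 1)))))) (Leaf 2 ((1,1,0),(0,1,0),(0,1,0))
    [0,0,0,0,0]))))) (Split 2 Fst [H] (Split 1 Trd [X] (Split 2 Snd [Z] (Split 2 Trd [H] (Split
    3 Trd [X] (Leaf 4 ((2,0,0),(1,0,0),(2,2,0)) [0,1,2,1]) (Vacuous 3)) (Vacuous 2)) (Vacuous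
    2)) (Vacuous 1)) (Split 1 Trd [X] (Split 2 Fst [X] (Split 2 Snd [Z] (Split 2 Trd [H] (Split
    3 Trd [X] (Leaf 4 ((1,0,0),(2,0,0),(2,0,0)) [4,0,4,1]) (Vacuous 3)) (Vacuous 2)) (Vacuous
    2)) (Vacuous 2)) (Vacuous 1)))) (Pick ([Z],[H],[X]) (Leaf 4 ((2,0,0),(2,0,0),(1,2,0))
    [2,0,0,2]) (Pick ([H],[X],[Z]) (Leaf 2 ((2,0,0),(0,0,0),(1,0,0)) [2,0,0,2]) (Pick
    ([H],[Z],[X]) (Leaf 2 ((2,0,0),(1,0,0),(0,0,0)) [2,0,0,2]) (Pick ([Z,X],[Z,H,W],[Z,H,W])
    (Leaf 2 ((1,0,0),(1,0,0),(1,0,0)) [2,0,0,1]) (Leaf 5 ((3,0,0),(2,1,0),(2,1,0))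
    [4,0,0]))))))) (Pick ([Z,H,X],[Z,H,W],[Z,H,W]) (Pick ([Z,H],[Z,H],[X]) (Pick ([Z],[X],[X])
    (Pick ([Z,H],[X],[W]) (Split 1 Trd [X] (Leaf 2 ((1,0,0),(0,1,0),(0,1,0)) [0,1,0,1,1,1])
    (Vacuous 1)) (Split 1 Trd [X] (Leaf 2 ((1,0,0),(0,0,0),(0,2,0)) [0,1,0,2,1]) (Vacuous 1)))
    (Pick ([Z],[H],[X]) (Split 1 Fst [H] (Split 1 Trd [X] (Leaf 2 ((1,0,0),(1,0,0),(0,1,0))
    [1,1,0,1,1]) (Vacuous 1)) (Vacuous 1)) (Split 1 Fst [H] (Split 1 Trd [X] (Leaf 6
    ((4,0,0),(2,0,0),(1,2,0)) [4,3,0,4]) (Vacuous 1)) (Vacuous 1)))) (Pick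
    ([Z,X],[Z,H,W],[Z,H,W]) (Leaf 2 ((1,0,0),(1,0,0),(1,0,0)) [2,0,1,1]) (Pick ([X],[Z],[X])
    (Leaf 3 ((1,0,0),(1,1,0),(1,1,0)) [2,0,1,1]) (Leaf 4 ((2,0,0),(2,2,0),(1,0,0)) [2,0,2]))))
    (Leaf 2 ((1,0,0),(0,0,0),(1,2,0)) [0,0]))) (Pick ([Z,X],[Z,X],[Z,H,W]) (Leaf 2
    ((1,0,0),(1,0,0),(1,0,0)) [2,1]) (Pick ([X],[Z,X],[X]) (Leaf 4 ((2,0,0),(2,0,0),(1,2,0))
    [2,1]) (Leaf 1 ((1,0,0),(1,0,0),(0,0,0)) [0])))"],
    code_simp, simp add: forbidden_bbb_ZZZ forbidden_permute[OF forbidden_bbb_ZZZ] forbidden_bbb_HZZ forbidden_permute[OF forbidden_bbb_HZZ] forbidden_bbb_XZZ forbidden_permute[OF forbidden_bbb_XZZ])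

lemma forbidden_bbb_HHZ: "forbidden T True True True ([H], [H], [Z])"
  by (rule forbidden_if_check[where Ds = "[([Z],[Z],[Z]), ([H],[Z],[Z]), ([Z],[H],[Z]), ([Z],[Z],[H]), ([X],[Z],[Z]), ([Z],[X],[Z]), ([Z],[Z],[X]), ([W],[Z],[Z]), ([Z],[W],[Z]), ([Z],[Z],[W])]" and t = "
    Pick ([Z,X],[Z,X],[Z,H,W]) (Pick ([Z,X],[H,W],[Z,H]) (Pick ([X],[H],[Z]) (Leaf 2
    ((0,0,0),(2,0,0),(1,0,0)) [2,0,0,2]) (Pick ([X],[H],[X]) (Pick ([H],[Z],[X]) (Leaf 2
    ((1,0,0),(1,0,0),(0,1,0)) [1,0,0,1,2]) (Pick ([Z],[H],[X]) (Pick ([H],[X],[X]) (Leaf 3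
    ((1,0,0),(2,0,0),(0,1,0)) [2,0,1,1,3,1]) (Leaf 2 ((1,0,0),(2,0,0),(0,0,0)) [2,0,0,0,2]))
    (Pick ([Z,H,W],[Z,X],[Z,H,W]) (Leaf 2 ((1,0,0),(1,0,0),(1,0,0)) [2,0,1,0,1]) (Pick
    ([Z],[H],[H]) (Leaf 5 ((2,1,0),(3,0,0),(2,1,0)) [2,0,0,0,2]) (Leaf 4
    ((2,2,0),(2,0,0),(1,0,0)) [2,0,2,0]))))) (Leaf 2 ((1,0,0),(1,0,0),(1,0,0)) [2,1,1]))) (Pick
    ([H],[X],[Z]) (Leaf 2 ((2,0,0),(0,0,0),(1,0,0)) [2,0,2]) (Pick ([X],[X],[Z]) (Pick
    ([Z,H,W],[X],[Z,H,W]) (Leaf 4 ((1,0,0),(0,2,0),(2,1,0)) [2,0,3,3]) (Leaf 2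
    ((0,0,0),(0,0,0),(1,2,0)) [2,0,2])) (Pick ([Z],[X],[H,W]) (Leaf 2 ((2,0,0),(0,0,0),(1,0,0))
    [2,0,2]) (Pick ([Z],[H],[X]) (Leaf 4 ((2,0,0),(2,0,0),(1,2,0)) [2,0,2]) (Pick
    ([Z,X],[Z,X],[H,X]) (Pick ([H,W],[Z,X],[Z,H]) (Leaf 4 ((2,0,0),(1,0,0),(2,2,0)) [2,0,1,1])
    (Pick ([Z,X],[X],[H,X]) (Leaf 5 ((2,1,0),(1,0,0),(2,3,0)) [2,0,1,1]) (Pick
    ([Z,X],[Z,H],[H,W]) (Leaf 3 ((1,1,0),(1,0,0),(1,1,0)) [1,0,1,1]) (Leaf 8
    ((4,2,0),(2,0,0),(3,4,0)) [2,0,2])))) (Leaf 3 ((2,1,0),(1,0,0),(1,1,0)) [0,0]))))))) (Pick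
    ([H],[X],[Z]) (Leaf 2 ((2,0,0),(0,0,0),(1,0,0)) [2,2]) (Pick ([H],[Z,X],[H,X]) (Pick
    ([H],[Z,X],[X]) (Pick ([H],[Z,X],[H]) (Leaf 2 ((2,0,0),(1,0,0),(0,0,0)) [2,0,1,1]) (Split 1
    Trd [X] (Leaf 4 ((2,0,0),(2,0,0),(1,2,0)) [2,2,0]) (Vacuous 1))) (Split 1 Trd [H] (Leaf 2
    ((1,0,0),(1,0,0),(1,0,0)) [2,1]) (Vacuous 1))) (Leaf 4 ((2,0,0),(4,0,0),(1,0,0)) [4])))"],
    code_simp, simp add: forbidden_bbb_ZZZ forbidden_permute[OF forbidden_bbb_ZZZ] forbidden_bbb_HZZ forbidden_permute[OF forbidden_bbb_HZZ] forbidden_bbb_XZZ forbidden_permute[OF forbidden_bbb_XZZ] forbidden_bbb_WZZ forbidden_permute[OF forbidden_bbb_WZZ])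

text \<open>This exclusion serves the certificate for \<open>(X, X, Z)\<close>, whose last leaf
  gives \<open>(W, H, Z)\<close> cost \<open>0\<close>.\<close>

lemma forbidden_bbb_WHZ: "forbidden T True True True ([W], [H], [Z])"
  by (rule forbidden_if_check[where Ds = "[([Z],[Z],[Z]), ([H],[Z],[Z]), ([Z],[H],[Z]), ([Z],[Z],[H]), ([X],[Z],[Z]), ([Z],[X],[Z]), ([Z],[Z],[X]), ([W],[Z],[Z]), ([Z],[W],[Z]), ([Z],[Z],[W]), ([H],[H],[Z]), ([H],[Z],[H]), ([Z],[H],[H])]" and t = "
    Pick ([X],[H],[Z]) (Leaf 2 ((0,0,0),(2,0,0),(1,0,0)) [2,2]) (Pick ([Z,X],[H,W],[Z,X]) (Pick
    ([Z],[X],[X]) (Pick ([Z,H],[Z,H,W],[X]) (Pick ([H],[X],[Z,H,W]) (Leaf 2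
    ((1,0,0),(0,1,0),(0,1,0)) [0,0,2,1,1]) (Leaf 2 ((1,0,0),(0,0,0),(0,2,0)) [0,0,2,2])) (Pick
    ([Z,H],[X],[Z,H,W]) (Leaf 2 ((1,0,0),(0,2,0),(0,0,0)) [0,0,2,2]) (Pick
    ([Z,H,X],[Z,H,W],[Z,H,W]) (Pick ([Z],[H,W],[H,W]) (Leaf 2 ((1,2,0),(0,0,0),(0,0,0))
    [0,0,2,1,1]) (Leaf 4 ((2,3,0),(0,1,0),(0,1,0)) [0,0,2,2])) (Leaf 2 ((1,1,0),(0,1,0),(0,1,0))
    [0,0,0])))) (Pick ([Z,H],[Z,H],[X]) (Pick ([X],[H],[H]) (Pick ([Z,H],[Z,X],[Z,H,W]) (Leaf 3
    ((1,0,0),(2,0,0),(1,0,0)) [3,1,1,2,1]) (Leaf 3 ((1,0,0),(2,0,0),(1,1,0)) [2,0,1,1])) (Pick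
    ([Z,H],[X],[Z,H]) (Pick ([H],[Z],[X]) (Pick ([H],[X],[Z]) (Leaf 6 ((4,0,0),(2,0,0),(1,2,0))
    [4,2,2,1,2,1]) (Leaf 8 ((4,0,0),(3,0,0),(2,4,0)) [4,2,3,2,1])) (Leaf 3
    ((1,0,0),(1,1,0),(1,1,0)) [1,1,1,1])) (Leaf 4 ((2,0,0),(2,0,0),(1,2,0)) [2,0,2]))) (Pick
    ([Z,H,X],[Z,H,W],[X]) (Pick ([Z,H],[X],[Z,H,X]) (Pick ([H],[X],[X]) (Pick
    ([Z,H],[X],[Z,H,W]) (Leaf 4 ((2,0,0),(1,2,0),(1,0,0)) [2,1,0,0,2,3]) (Pick
    ([Z,X],[Z,H,W],[Z,H,W]) (Leaf 4 ((2,2,0),(2,0,0),(1,0,0)) [2,0,0,0,0,2]) (Leaf 7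
    ((3,2,0),(2,1,0),(2,3,0)) [4,0,0,0,0]))) (Split 3 Trd [Z,H] (Leaf 4
    ((2,1,0),(1,0,0),(2,0,0)) [3,2,0,2]) (Vacuous 3))) (Leaf 4 ((2,2,0),(2,0,0),(1,0,0))
    [2,0,2])) (Split 1 Fst [X] (Split 1 Snd [W] (Split 1 Trd [Z] (Leaf 2
    ((1,0,0),(1,0,0),(1,0,0)) [2,1]) (Vacuous 1)) (Vacuous 1)) (Vacuous 1))))) (Pick
    ([Z],[X],[X]) (Pick ([H],[Z,H,W],[X]) (Leaf 2 ((1,0,0),(0,1,0),(0,1,0)) [1,2,1]) (Leaf 2
    ((1,0,0),(0,2,0),(0,0,0)) [2,2])) (Pick ([Z],[X],[H,W]) (Pick ([X],[Z,H],[H]) (Leaf 3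
    ((1,0,0),(1,1,0),(2,0,0)) [2,1,1]) (Leaf 4 ((2,0,0),(1,2,0),(2,0,0)) [2,2])) (Pick
    ([X],[H],[H]) (Leaf 2 ((1,0,0),(1,0,0),(1,0,0)) [2,1]) (Leaf 4 ((4,0,0),(1,0,0),(2,0,0))
    [4])))))"],
    code_simp, simp add: forbidden_bbb_ZZZ forbidden_permute[OF forbidden_bbb_ZZZ] forbidden_bbb_HZZ forbidden_permute[OF forbidden_bbb_HZZ] forbidden_bbb_XZZ forbidden_permute[OF forbidden_bbb_XZZ] forbidden_bbb_WZZ forbidden_permute[OF forbidden_bbb_WZZ] forbidden_bbb_HHZ forbidden_permute[OF forbidden_bbb_HHZ])

lemma forbidden_bbb_XXZ: "forbidden T True True True ([X], [X], [Z])"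
  by (rule forbidden_if_check[where Ds = "[([Z],[Z],[Z]), ([H],[Z],[Z]), ([Z],[H],[Z]), ([Z],[Z],[H]), ([X],[Z],[Z]), ([Z],[X],[Z]), ([Z],[Z],[X]), ([W],[Z],[Z]), ([Z],[W],[Z]), ([Z],[Z],[W]), ([H],[H],[Z]), ([H],[Z],[H]), ([Z],[H],[H]), ([W],[H],[Z]), ([H],[W],[Z]), ([W],[Z],[H]), ([Z],[W],[H]), ([H],[Z],[W]), ([Z],[H],[W])]" and t = "
    Pick ([X],[Z,H,W],[Z,H]) (Pick ([Z,H,W],[X],[Z,H]) (Leaf 2 ((0,1,0),(0,1,0),(1,0,0))
    [2,1,1]) (Leaf 2 ((0,2,0),(0,0,0),(1,0,0)) [2,2])) (Pick ([Z,H,W],[X],[Z,H]) (Leaf 2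
    ((0,0,0),(0,2,0),(1,0,0)) [2,2]) (Pick ([W],[W],[Z]) (Leaf 2 ((0,0,0),(0,0,0),(1,2,0))
    [2,2]) (Pick ([Z,H,W],[Z,H,W],[H,X]) (Leaf 4 ((0,1,0),(0,1,0),(2,3,0)) [2,2]) (Leaf 2
    ((0,1,0),(0,1,0),(1,1,0)) [0]))))"],
    code_simp, simp add: forbidden_bbb_ZZZ forbidden_permute[OF forbidden_bbb_ZZZ] forbidden_bbb_HZZ forbidden_permute[OF forbidden_bbb_HZZ] forbidden_bbb_XZZ forbidden_permute[OF forbidden_bbb_XZZ] forbidden_bbb_WZZ forbidden_permute[OF forbidden_bbb_WZZ] forbidden_bbb_HHZ forbidden_permute[OF forbidden_bbb_HHZ] forbidden_bbb_WHZ forbidden_permute[OF forbidden_bbb_WHZ])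

lemma forbidden_bbb_XHZ: "forbidden T True True True ([X], [H], [Z])"
  by (rule forbidden_if_check[where Ds = "[([Z],[Z],[Z]), ([H],[Z],[Z]), ([Z],[H],[Z]), ([Z],[Z],[H]), ([X],[Z],[Z]), ([Z],[X],[Z]), ([Z],[Z],[X]), ([W],[Z],[Z]), ([Z],[W],[Z]), ([Z],[Z],[W]), ([H],[H],[Z]), ([H],[Z],[H]), ([Z],[H],[H]), ([W],[H],[Z]), ([H],[W],[Z]), ([W],[Z],[H]), ([Z],[W],[H]), ([H],[Z],[W]), ([Z],[H],[W]), ([X],[X],[Z]), ([X],[Z],[X]), ([Z],[X],[X])]" and t = "
    Pick ([H,W],[X],[Z,X]) (Pick ([Z,H,W],[Z,H,W],[Z,X]) (Pick ([H,W],[Z,H,W],[Z,H,W]) (Pick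
    ([X],[X],[H]) (Leaf 2 ((0,1,0),(1,0,0),(1,0,0)) [2,0,0,1,1]) (Leaf 2
    ((0,0,0),(1,0,0),(1,1,0)) [2,1,0,1])) (Pick ([X],[Z,X],[H,W]) (Leaf 3
    ((0,1,0),(1,1,0),(1,1,0)) [2,1,0,1]) (Leaf 4 ((0,0,0),(2,2,0),(1,2,0)) [2,2,0]))) (Pick
    ([X],[X],[X]) (Leaf 2 ((0,2,0),(0,0,0),(1,0,0)) [2,0,1]) (Leaf 2 ((0,1,0),(1,0,0),(1,0,0))
    [2,0]))) (Pick ([Z,H,W],[Z,X],[H,X]) (Pick ([Z,H,W],[Z,H],[X]) (Pick ([H,W],[Z,H,W],[Z,H,W])
    (Leaf 2 ((0,0,0),(1,0,0),(1,1,0)) [1,1,1,1]) (Pick ([X],[Z,X],[H]) (Leaf 5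
    ((0,3,0),(2,1,0),(2,1,0)) [2,0,0,2]) (Leaf 5 ((0,1,0),(2,1,0),(2,3,0)) [2,2,0]))) (Leaf 2
    ((0,1,0),(1,1,0),(1,0,0)) [0,0])) (Leaf 2 ((0,1,0),(1,0,0),(1,1,0)) [0]))"],
    code_simp, simp add: forbidden_bbb_ZZZ forbidden_permute[OF forbidden_bbb_ZZZ] forbidden_bbb_HZZ forbidden_permute[OF forbidden_bbb_HZZ] forbidden_bbb_XZZ forbidden_permute[OF forbidden_bbb_XZZ] forbidden_bbb_WZZ forbidden_permute[OF forbidden_bbb_WZZ] forbidden_bbb_HHZ forbidden_permute[OF forbidden_bbb_HHZ] forbidden_bbb_WHZ forbidden_permute[OF forbidden_bbb_WHZ] forbidden_bbb_XXZ forbidden_permute[OF forbidden_bbb_XXZ])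

text \<open>The box in \<open>Ds\<close> says that \<open>X\<close> does not occur in the third
  colour. By relabelling, an exclusion with \<open>Z\<close> there holds for all three
  names.\<close>

lemma forbidden_bbg_ZZZ: "forbidden T True True False ([Z], [Z], [Z])"
  by (rule forbidden_if_check[where Ds = "[([Z,H,W,X],[Z,H,W,X],[X])]" and t = "
    Pick ([Z],[Z],[H,W]) (Leaf 2 ((1,0,0),(1,0,0),(0,0,0)) [2,2]) (Pick ([Z,H,X],[Z,H,X],[H,W])
    (Pick ([W],[Z,X],[H,W]) (Pick ([Z],[X],[Z]) (Leaf 2 ((1,0,0),(0,0,0),(2,0,0)) [2,0,0,2])
    (Pick ([X],[X],[Z]) (Pick ([X],[Z],[Z]) (Leaf 2 ((0,0,0),(1,0,0),(2,0,0)) [2,0,0,0,2]) (Pick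
    ([Z,H,W],[Z,H,W],[H,W]) (Leaf 2 ((1,0,0),(1,0,0),(1,0,0)) [2,1,0,0,1]) (Pick
    ([Z,X],[Z,X],[H,W]) (Leaf 3 ((1,1,0),(1,1,0),(1,0,0)) [2,1,0,0,1]) (Leaf 5
    ((2,1,0),(2,1,0),(3,0,0)) [2,2,0,0])))) (Leaf 2 ((1,0,0),(1,0,0),(1,0,0)) [2,1,1]))) (Leaf 4
    ((1,0,0),(2,0,0),(4,0,0)) [4,0])) (Leaf 2 ((1,0,0),(1,0,0),(2,0,0)) [0]))"],
    code_simp, simp add: forbidden_X3)

lemma forbidden_bbg_HZZ: "forbidden T True True False ([H], [Z], [Z])"
  by (rule forbidden_if_check[where Ds = "[([Z,H,W,X],[Z,H,W,X],[X]), ([Z],[Z],[Z,H,W])]" and t = "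
    Pick ([Z,H],[Z,H],[H,W]) (Pick ([Z,X],[Z,H],[Z]) (Leaf 2 ((1,0,0),(1,0,0),(1,0,0)) [2,1,1])
    (Leaf 2 ((2,0,0),(1,0,0),(0,0,0)) [2,2])) (Pick ([X],[Z],[Z]) (Leaf 2
    ((0,0,0),(1,0,0),(2,0,0)) [2,2]) (Pick ([Z,X],[Z,H,W],[H,W]) (Pick ([X],[X],[Z]) (Pick
    ([X],[Z],[H,W]) (Pick ([X],[H],[Z]) (Leaf 4 ((0,2,0),(1,0,0),(2,0,0)) [2,0,3,2,4]) (Pick
    ([Z,H,W],[Z,H,W],[H,W]) (Leaf 2 ((1,0,0),(1,1,0),(0,0,0)) [2,0,0,1,1]) (Leaf 2
    ((0,0,0),(1,2,0),(0,0,0)) [2,0,0,2]))) (Pick ([Z],[X],[Z]) (Pick ([Z,H],[X],[H,W]) (Leaf 2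
    ((1,0,0),(0,1,0),(1,0,0)) [1,0,0,2,1]) (Leaf 2 ((1,0,0),(0,0,0),(2,0,0)) [2,0,0,2])) (Pick
    ([Z,X],[H,X],[H,W]) (Pick ([Z,H],[X],[H,W]) (Pick ([Z,H,W],[Z,H,W],[H,W]) (Leaf 2
    ((1,0,0),(1,1,0),(0,0,0)) [1,0,0,1,1,1]) (Pick ([Z,X],[H],[Z]) (Leaf 4
    ((1,0,0),(2,2,0),(2,0,0)) [2,0,0,1,0,1]) (Leaf 5 ((2,1,0),(2,3,0),(1,0,0)) [2,0,0,2,0])))
    (Leaf 5 ((2,1,0),(2,1,0),(3,0,0)) [3,0,1,0])) (Leaf 2 ((1,0,0),(1,1,0),(1,0,0)) [0,0,0]))))
    (Pick ([Z,X],[H],[Z]) (Leaf 2 ((1,0,0),(1,0,0),(1,0,0)) [2,1,1]) (Leaf 2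
    ((2,0,0),(1,0,0),(0,0,0)) [2,2]))) (Pick ([Z,H],[X],[H,W]) (Leaf 4 ((2,0,0),(1,2,0),(2,0,0))
    [2,1]) (Leaf 4 ((2,0,0),(1,1,0),(3,0,0)) [3]))))"],
    code_simp, simp add: forbidden_X3 forbidden_relabel[OF forbidden_bbg_ZZZ] forbidden_swap12[OF forbidden_relabel[OF forbidden_bbg_ZZZ]])

lemma forbidden_bbg_WZZ: "forbidden T True True False ([W], [Z], [Z])"
  by (rule forbidden_if_check[where Ds = "[([Z,H,W,X],[Z,H,W,X],[X]), ([Z],[Z],[Z,H,W]), ([H],[Z],[Z,H,W]), ([Z],[H],[Z,H,W])]" and t = "
    Pick ([Z,X],[Z,H,W],[Z]) (Pick ([X],[Z],[Z]) (Leaf 2 ((0,0,0),(1,0,0),(2,0,0)) [2,0,2])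
    (Pick ([X],[H],[Z]) (Pick ([Z,X],[X],[Z]) (Pick ([Z],[X],[Z]) (Pick ([Z],[X],[H,W]) (Leaf 2
    ((1,0,0),(0,2,0),(0,0,0)) [0,0,0,0,2,2]) (Leaf 3 ((1,0,0),(1,1,0),(2,0,0)) [2,0,1,0,1]))
    (Pick ([H],[X],[Z]) (Split 1 Snd [H,W] (Split 3 Fst [X] (Leaf 1 ((0,0,0),(0,0,0),(1,0,0))
    [1,0,1,1,1]) (Vacuous 3)) (Vacuous 1)) (Split 1 Snd [H,W] (Split 3 Fst [X] (Leaf 4
    ((1,2,0),(1,0,0),(2,0,0)) [2,0,4,2]) (Vacuous 3)) (Vacuous 1)))) (Leaf 2
    ((1,0,0),(1,0,0),(1,0,0)) [2,0,2])) (Pick ([Z,X],[Z,H,W],[H,W]) (Pick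
    ([Z,H,W],[Z,H,W],[H,W]) (Leaf 2 ((1,0,0),(1,0,0),(0,0,0)) [2,2,2,2]) (Pick ([Z],[X],[Z])
    (Leaf 4 ((1,0,0),(1,2,0),(2,0,0)) [2,2,0,2]) (Leaf 3 ((1,1,0),(1,1,0),(1,0,0)) [2,2,0])))
    (Leaf 2 ((1,0,0),(1,2,0),(0,0,0)) [0,0])))) (Pick ([X],[Z,H],[H,W]) (Pick
    ([Z,H,W],[Z,H,W],[H,W]) (Pick ([H],[H],[Z]) (Leaf 2 ((1,0,0),(1,1,0),(0,0,0)) [1,1,1,1])
    (Pick ([Z,H,X],[Z,H,W],[W]) (Pick ([Z,H,X],[Z,H,W],[H]) (Split 3 Fst [H] (Leaf 2
    ((1,0,0),(1,1,0),(0,0,0)) [2,0,0,1,1]) (Split 4 Fst [H] (Leaf 2 ((1,0,0),(1,1,0),(0,0,0))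
    [2,0,0,1,1]) (Leaf 2 ((1,0,0),(1,0,0),(0,0,0)) [2,0,2,2,2]))) (Split 1 Trd [W] (Leaf 3
    ((1,0,0),(1,2,0),(0,0,1)) [2,1,1,0]) (Vacuous 1))) (Split 1 Trd [H] (Leaf 3
    ((1,0,0),(1,2,0),(0,1,0)) [2,1,1]) (Vacuous 1)))) (Pick ([X],[Z],[H,W]) (Leaf 2
    ((0,0,0),(1,2,0),(0,0,0)) [2,1,1]) (Pick ([H],[H],[Z]) (Leaf 4 ((1,0,0),(2,3,0),(1,0,0))
    [2,1,1]) (Leaf 4 ((1,0,0),(2,4,0),(0,0,0)) [2,2])))) (Leaf 2 ((1,0,0),(1,2,0),(0,0,0)) [0]))"],
    code_simp, simp add: forbidden_X3 forbidden_relabel[OF forbidden_bbg_ZZZ] forbidden_swap12[OF forbidden_relabel[OF forbidden_bbg_ZZZ]] forbidden_relabel[OF forbidden_bbg_HZZ] forbidden_swap12[OF forbidden_relabel[OF forbidden_bbg_HZZ]])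

lemma forbidden_bbg_XZZ: "forbidden T True True False ([X], [Z], [Z])"
  by (rule forbidden_if_check[where Ds = "[([Z,H,W,X],[Z,H,W,X],[X]), ([Z],[Z],[Z,H,W]), ([H],[Z],[Z,H,W]), ([Z],[H],[Z,H,W]), ([W],[Z],[Z,H,W]), ([Z],[W],[Z,H,W])]" and t = "
    Pick ([Z,H,W],[H,X],[Z]) (Pick ([X],[Z],[H,W]) (Leaf 2 ((0,2,0),(1,0,0),(0,0,0)) [2,0,2])
    (Pick ([Z,H,W],[X],[Z]) (Pick ([Z,H,W],[H,X],[H,W]) (Pick ([H,W],[H],[Z]) (Leaf 2
    ((0,0,0),(1,1,0),(1,0,0)) [1,0,1,1,1]) (Pick ([X],[H],[H,W]) (Leaf 2
    ((0,1,0),(1,1,0),(0,0,0)) [1,0,0,1,1]) (Leaf 4 ((0,1,0),(2,3,0),(1,0,0)) [2,0,0,2]))) (Leaf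
    2 ((0,1,0),(1,1,0),(1,0,0)) [0,0,0])) (Split 1 Fst [H,W] (Split 1 Snd [H] (Leaf 2
    ((0,1,0),(1,0,0),(1,0,0)) [2,1]) (Vacuous 1)) (Vacuous 1)))) (Leaf 2
    ((0,2,0),(1,0,0),(0,0,0)) [2])"],
    code_simp, simp add: forbidden_X3 forbidden_relabel[OF forbidden_bbg_ZZZ] forbidden_swap12[OF forbidden_relabel[OF forbidden_bbg_ZZZ]] forbidden_relabel[OF forbidden_bbg_HZZ] forbidden_swap12[OF forbidden_relabel[OF forbidden_bbg_HZZ]] forbidden_relabel[OF forbidden_bbg_WZZ] forbidden_swap12[OF forbidden_relabel[OF forbidden_bbg_WZZ]])

lemma forbidden_bgg_ZZZ: "forbidden T True False False ([Z], [Z], [Z])"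
  by (rule forbidden_if_check[where Ds = "[([Z,H,W,X],[X],[Z,H,W,X]), ([Z,H,W,X],[Z,H,W,X],[X])]" and t = "
    Pick ([Z],[Z],[H,W]) (Leaf 2 ((1,0,0),(2,0,0),(0,0,0)) [2,2]) (Pick ([Z,H,W],[H,W],[Z])
    (Pick ([H],[Z],[H,W]) (Leaf 2 ((1,0,0),(1,0,0),(1,0,0)) [2,1,1]) (Leaf 2
    ((1,0,0),(0,0,0),(2,0,0)) [2,2])) (Pick ([H],[Z],[H,W]) (Leaf 2 ((1,0,0),(2,0,0),(0,0,0))
    [2,2]) (Pick ([Z],[H,W],[H,W]) (Leaf 2 ((1,2,0),(0,0,0),(0,0,0)) [2,2]) (Pick
    ([H,X],[H,W],[H,W]) (Leaf 4 ((2,3,0),(1,0,0),(1,0,0)) [2,2]) (Leaf 2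
    ((1,1,0),(1,0,0),(1,0,0)) [0])))))"],
    code_simp, simp add: forbidden_X3 forbidden_X2)

lemma forbidden_ggg_ZZZ: "forbidden T False False False ([Z], [Z], [Z])"
  by (rule forbidden_if_check[where Ds = "[([X],[Z,H,W,X],[Z,H,W,X]), ([Z,H,W,X],[X],[Z,H,W,X]), ([Z,H,W,X],[Z,H,W,X],[X])]" and t = "
    Pick ([W],[H,W],[Z]) (Pick ([H],[H,W],[Z]) (Pick ([H,W],[Z,H],[Z]) (Pick ([H,W],[W],[Z])
    (Split 1 Snd [H] (Leaf 1 ((0,0,0),(0,0,0),(1,0,0)) [1,1,1,0,1]) (Leaf 1
    ((0,0,0),(0,0,0),(1,0,0)) [1,1,1,1,0])) (Pick ([H,W],[Z],[Z]) (Leaf 1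
    ((0,0,0),(0,0,0),(1,0,0)) [1,1,1,0,1]) (Pick ([H,W],[H],[H,W]) (Split 1 Snd [H] (Split 2 Snd
    [H] (Leaf 1 ((0,0,0),(0,1,0),(0,0,0)) [0,1,1,0,1]) (Vacuous 2)) (Vacuous 1)) (Split 1 Snd
    [H] (Split 2 Snd [H] (Leaf 2 ((1,0,0),(0,1,0),(1,0,0)) [0,2,2,0]) (Vacuous 2)) (Vacuous
    1))))) (Pick ([H,W],[W],[H,W]) (Split 1 Snd [W] (Split 2 Snd [W] (Leaf 1
    ((0,0,0),(0,0,1),(0,0,0)) [0,1,1,1]) (Vacuous 2)) (Vacuous 1)) (Split 1 Snd [W] (Split 2 Snd
    [W] (Leaf 2 ((1,0,0),(0,0,1),(1,0,0)) [0,2,2]) (Vacuous 2)) (Vacuous 1)))) (Pick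
    ([H],[Z],[H,W]) (Pick ([H,W],[Z],[Z]) (Leaf 1 ((0,0,0),(1,0,0),(0,0,0)) [1,0,1,1]) (Pick
    ([H,W],[Z],[W]) (Pick ([H,W],[Z],[H]) (Leaf 1 ((0,0,0),(1,0,0),(0,0,0)) [1,0,1,1,1]) (Split
    2 Trd [W] (Leaf 2 ((1,0,0),(1,0,0),(0,0,1)) [2,0,2,0]) (Vacuous 2))) (Split 2 Trd [H] (Leaf
    2 ((1,0,0),(1,0,0),(0,1,0)) [2,0,2]) (Vacuous 2)))) (Pick ([H],[Z],[Z]) (Pick
    ([Z],[H,W],[Z]) (Leaf 1 ((0,0,0),(0,0,0),(1,0,0)) [1,1,1,1]) (Pick ([Z],[Z],[H,W]) (Leaf 1
    ((0,0,0),(1,0,0),(0,0,0)) [1,0,1,1]) (Leaf 2 ((0,0,1),(1,0,0),(1,0,0)) [2,0,2]))) (Pick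
    ([Z],[H,W],[Z]) (Pick ([H],[H,W],[H,W]) (Pick ([Z,H],[W],[H,W]) (Pick ([Z,H],[H],[H,W])
    (Leaf 1 ((1,0,0),(0,0,0),(0,0,0)) [1,0,1,0,1,1]) (Split 3 Snd [W] (Leaf 2
    ((1,0,1),(0,0,1),(0,0,0)) [1,1,1,1,0]) (Vacuous 3))) (Split 3 Snd [H] (Leaf 2
    ((1,0,1),(0,1,0),(0,0,0)) [1,1,1,1]) (Vacuous 3))) (Leaf 1 ((1,0,1),(0,0,0),(0,0,0))
    [0,0,0])) (Pick ([H],[H,W],[H,W]) (Split 1 Snd [H] (Pick ([W],[W],[Z]) (Leaf 1
    ((0,0,1),(0,0,0),(0,0,0)) [0,1,1,1]) (Pick ([Z,H],[H,W],[H]) (Pick ([Z,H],[H,W],[W]) (Split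
    2 Trd [H] (Leaf 2 ((1,0,1),(0,1,0),(0,0,0)) [1,1,1,0,1]) (Leaf 2 ((1,0,1),(0,1,0),(0,0,0))
    [1,1,1,1,0])) (Split 2 Trd [H] (Leaf 3 ((1,0,2),(0,1,0),(0,1,0)) [1,1,2,0]) (Vacuous 2)))
    (Split 2 Trd [W] (Leaf 3 ((1,0,2),(0,1,0),(0,0,1)) [1,1,2]) (Vacuous 2)))) (Pick
    ([W],[H],[Z]) (Leaf 1 ((0,0,1),(0,0,0),(0,0,0)) [0,1,1,1]) (Pick ([Z,H],[H,W],[H]) (Pick
    ([Z,H],[H,W],[W]) (Split 2 Trd [H] (Leaf 2 ((1,0,1),(0,0,1),(0,0,0)) [1,1,1,0,1]) (Leaf 2
    ((1,0,1),(0,0,1),(0,0,0)) [1,1,1,1,0])) (Split 2 Trd [H] (Leaf 3 ((1,0,2),(0,0,1),(0,1,0))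
    [1,1,2,0]) (Vacuous 2))) (Split 2 Trd [W] (Leaf 3 ((1,0,2),(0,0,1),(0,0,1)) [1,1,2])
    (Vacuous 2))))) (Leaf 1 ((1,0,1),(0,0,0),(0,0,0)) [0,0])))))) (Pick ([H],[H,W],[Z]) (Pick
    ([W],[Z],[H,W]) (Pick ([H,W],[Z],[Z]) (Leaf 1 ((0,0,0),(1,0,0),(0,0,0)) [1,0,1,1]) (Pick
    ([H,W],[Z],[W]) (Pick ([H,W],[Z],[H]) (Leaf 1 ((0,0,0),(1,0,0),(0,0,0)) [1,0,1,1,1]) (Split
    2 Trd [W] (Leaf 2 ((1,0,0),(1,0,0),(0,0,1)) [2,0,2,0]) (Vacuous 2))) (Split 2 Trd [H] (Leaf
    2 ((1,0,0),(1,0,0),(0,1,0)) [2,0,2]) (Vacuous 2)))) (Pick ([W],[Z],[Z]) (Pick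
    ([Z],[H,W],[Z]) (Leaf 1 ((0,0,0),(0,0,0),(1,0,0)) [1,1,1,1]) (Pick ([Z],[Z],[H,W]) (Leaf 1
    ((0,0,0),(1,0,0),(0,0,0)) [1,0,1,1]) (Leaf 2 ((0,1,0),(1,0,0),(1,0,0)) [2,0,2]))) (Pick
    ([Z],[H,W],[Z]) (Pick ([H],[Z],[Z]) (Leaf 2 ((1,1,0),(0,0,0),(1,0,0)) [1,1,1,1]) (Pick
    ([Z],[Z],[H,W]) (Leaf 1 ((1,0,0),(0,0,0),(0,0,0)) [1,0,1,1]) (Pick ([H],[W],[Z]) (Pick
    ([H],[H],[Z]) (Leaf 2 ((1,1,0),(0,0,0),(1,0,0)) [1,0,1,1,1]) (Pick ([Z],[H],[H,W]) (Leaf 1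
    ((1,0,0),(0,0,0),(0,0,0)) [1,0,1,0,1]) (Leaf 2 ((1,0,0),(0,0,1),(1,0,0)) [2,0,2,0]))) (Pick
    ([Z],[W],[H,W]) (Leaf 1 ((1,0,0),(0,0,0),(0,0,0)) [1,0,1,1]) (Leaf 2
    ((1,0,0),(0,1,0),(1,0,0)) [2,0,2]))))) (Pick ([W],[H,W],[H,W]) (Split 2 Trd [H] (Split 1 Snd
    [H] (Pick ([H],[W],[Z]) (Leaf 1 ((0,1,0),(0,0,0),(0,0,0)) [0,1,1,1]) (Pick ([Z],[H,W],[W])
    (Leaf 2 ((1,1,0),(0,1,0),(0,0,0)) [1,1,1,1]) (Leaf 2 ((0,1,0),(0,1,0),(0,1,0)) [1,1,2])))
    (Pick ([H],[H],[Z]) (Leaf 1 ((0,1,0),(0,0,0),(0,0,0)) [0,1,1,1]) (Pick ([Z],[H,W],[W]) (Leaf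
    2 ((1,1,0),(0,0,1),(0,0,0)) [1,1,1,1]) (Leaf 2 ((0,1,0),(0,0,1),(0,1,0)) [1,1,2])))) (Split
    1 Snd [H] (Pick ([H],[W],[Z]) (Leaf 1 ((0,1,0),(0,0,0),(0,0,0)) [0,1,1,1]) (Pick
    ([Z],[H,W],[H]) (Leaf 2 ((1,1,0),(0,1,0),(0,0,0)) [1,1,1,1]) (Leaf 2
    ((0,1,0),(0,1,0),(0,0,1)) [1,1,2]))) (Pick ([H],[H],[Z]) (Leaf 1 ((0,1,0),(0,0,0),(0,0,0))
    [0,1,1,1]) (Pick ([Z],[H,W],[H]) (Leaf 2 ((1,1,0),(0,0,1),(0,0,0)) [1,1,1,1]) (Leaf 2
    ((0,1,0),(0,0,1),(0,0,1)) [1,1,2]))))) (Leaf 1 ((1,1,0),(0,0,0),(0,0,0)) [0,0]))))) (Pick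
    ([H,W],[Z],[H,W]) (Pick ([Z],[H,W],[H,W]) (Pick ([H,W],[Z],[W]) (Pick ([Z],[H,W],[W]) (Leaf
    2 ((1,0,0),(1,0,0),(0,0,1)) [2,0,0,1,1]) (Leaf 1 ((0,0,0),(1,0,0),(0,0,0)) [1,0,0,1]))
    (Split 1 Trd [H] (Leaf 2 ((1,0,0),(1,0,0),(0,1,0)) [2,1,1]) (Vacuous 1))) (Leaf 1
    ((0,0,0),(1,0,0),(0,0,0)) [1,1])) (Pick ([Z],[H,W],[H,W]) (Leaf 1 ((1,0,0),(0,0,0),(0,0,0))
    [1,1]) (Leaf 2 ((1,0,0),(1,0,0),(1,0,0)) [2]))))"],
    code_simp, simp add: forbidden_X3 forbidden_X2 forbidden_X1)

end

section \<open>The count for each pattern of flags\<close>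

text \<open>With costs \<open>0\<close>, \<open>1\<close>, \<open>2\<close>, \<open>1\<close> for
  \<open>Z\<close>, \<open>H\<close>, \<open>W\<close>, \<open>X\<close>, every triple that is not
  excluded costs at least \<open>3\<close>. Each colour has budget \<open>2\<close>, so
  \<open>3 * card V\<close> is at most \<open>6 * N\<close>.\<close>

lemma card_le_bbb:
  assumes "config True True True V N f g h"
  shows "card V \<le> 2 * N"
  by (rule card_le_if_check[OF _ _ assms, where Ds = "[([Z],[Z],[Z]), ([H],[Z],[Z]), ([Z],[H],[Z]), ([Z],[Z],[H]), ([X],[Z],[Z]), ([Z],[X],[Z]), ([Z],[Z],[X]), ([W],[Z],[Z]), ([Z],[W],[Z]), ([Z],[Z],[W]), ([H],[H],[Z]), ([H],[Z],[H]), ([Z],[H],[H]), ([W],[H],[Z]), ([H],[W],[Z]), ([W],[Z],[H]), ([Z],[W],[H]), ([H],[Z],[W]), ([Z],[H],[W]), ([X],[X],[Z]), ([X],[Z],[X]), ([Z],[X],[X]), ([X],[H],[Z]), ([H],[X],[Z]), ([X],[Z],[H]), ([Z],[X],[H]), ([H],[Z],[X]), ([Z],[H],[X])]" and t = "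
    Leaf 3 ((1,1,0),(1,1,0),(1,1,0)) []"],
    code_simp, simp add: forbidden_bbb_ZZZ forbidden_permute[OF forbidden_bbb_ZZZ] forbidden_bbb_HZZ forbidden_permute[OF forbidden_bbb_HZZ] forbidden_bbb_XZZ forbidden_permute[OF forbidden_bbb_XZZ] forbidden_bbb_WZZ forbidden_permute[OF forbidden_bbb_WZZ] forbidden_bbb_HHZ forbidden_permute[OF forbidden_bbb_HHZ] forbidden_bbb_WHZ forbidden_permute[OF forbidden_bbb_WHZ] forbidden_bbb_XXZ forbidden_permute[OF forbidden_bbb_XXZ] forbidden_bbb_XHZ forbidden_permute[OF forbidden_bbb_XHZ])

text \<open>All triples with \<open>Z\<close> in the first colour are excluded. Hence the doubled
  weight of its large component and the number of vertices outside, each at most \<open>N\<close>,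
  together account for every vertex.\<close>

lemma card_le_bbg:
  assumes "config True True False V N f g h"
  shows "card V \<le> 2 * N"
  by (rule card_le_if_check[OF _ _ assms, where Ds = "[([Z,H,W,X],[Z,H,W,X],[X]), ([Z],[Z],[Z,H,W]), ([H],[Z],[Z,H,W]), ([Z],[H],[Z,H,W]), ([W],[Z],[Z,H,W]), ([Z],[W],[Z,H,W]), ([X],[Z],[Z,H,W]), ([Z],[X],[Z,H,W])]" and t = "
    Leaf 1 ((1,1,0),(0,0,0),(0,0,0)) []"],
    code_simp, simp add: forbidden_X3 forbidden_relabel[OF forbidden_bbg_ZZZ] forbidden_swap12[OF forbidden_relabel[OF forbidden_bbg_ZZZ]] forbidden_relabel[OF forbidden_bbg_HZZ] forbidden_swap12[OF forbidden_relabel[OF forbidden_bbg_HZZ]] forbidden_relabel[OF forbidden_bbg_WZZ] forbidden_swap12[OF forbidden_relabel[OF forbidden_bbg_WZZ]] forbidden_relabel[OF forbidden_bbg_XZZ] forbidden_swap12[OF forbidden_relabel[OF forbidden_bbg_XZZ]])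

text \<open>Relabelling both grouped colours again excludes \<open>Z\<close> in the first colour
  altogether.\<close>

lemma card_le_bgg:
  assumes "config True False False V N f g h"
  shows "card V \<le> 2 * N"
  by (rule card_le_if_check[OF _ _ assms, where Ds = "[([Z,H,W,X],[X],[Z,H,W,X]), ([Z,H,W,X],[Z,H,W,X],[X]), ([Z],[Z,H,W],[Z,H,W])]" and t = "
    Leaf 1 ((1,1,0),(0,0,0),(0,0,0)) []"],
    code_simp, simp add: forbidden_X3 forbidden_X2 forbidden_relabel[OF forbidden_swap23[OF forbidden_relabel[OF forbidden_bgg_ZZZ]]])

text \<open>Relabelling all three colours excludes every triple, so zero multipliers
  suffice.\<close>

lemma card_le_ggg:
  assumes "config False False False V N f g h"
  shows "card V \<le> 2 * N"
  by (rule card_le_if_check[OF _ _ assms, where Ds = "[([X],[Z,H,W,X],[Z,H,W,X]), ([Z,H,W,X],[X],[Z,H,W,X]), ([Z,H,W,X],[Z,H,W,X],[X]), ([Z,H,W],[Z,H,W],[Z,H,W])]" and t = "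
    Leaf 1 ((0,0,0),(0,0,0),(0,0,0)) []"],
    code_simp, simp add: forbidden_X3 forbidden_X2 forbidden_X1 forbidden_relabel[OF forbidden_swap23[OF forbidden_swap12[OF forbidden_relabel[OF forbidden_swap23[OF forbidden_relabel[OF forbidden_ggg_ZZZ]]]]]])

theorem config_card_le:
  assumes "config k l m V N f g h"
  shows "card V \<le> 2 * N"
proof (cases k; cases l; cases m)
qed (use assms in \<open>auto intro: card_le_bbb card_le_bbg card_le_bgg card_le_ggg
  card_le_bbg[OF config_swap23] card_le_bbg[OF config_swap23[OF config_swap12]]
  card_le_bgg[OF config_swap12] card_le_bgg[OF config_swap12[OF config_swap23]]\<close>)

section \<open>From colourings to states\<close>

text \<open>Weights are doubled: \<open>2\<close> on the barrier and \<open>1\<close> on blocks with more than \<open>L\<close> vertices. The number of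
  such blocks bounds the loss from rounding half their sizes down.\<close>

lemma component_weights:
  assumes C: "finite C" "F \<subseteq> [C]\<^bsup>2\<^esup>" and "even n" "0 < L"
    and unsat: "\<And>M. matching F M \<Longrightarrow> \<not> saturates M n"
  obtains w :: "'a \<Rightarrow> nat" where "\<And>v. w v \<le> 2" "(\<Sum>v\<in>C. w v) \<le> n + card C div L"
    "\<And>v. card {u \<in> C. {v, u} \<in> F \<and> w v + w u < 2} \<le> L"
proof -
  obtain S P m where S: "S \<subseteq> C" "partition_on (C - S) P"
      "\<And>e. e \<in> F \<Longrightarrow> e \<inter> S \<noteq> {} \<or> (\<exists>B\<in>P. e \<subseteq> B)"
    and m: "pairing F m" "2 * card S + (\<Sum>B\<in>P. card B - 1) \<le> card (covered m)"
    using barrier_exists[OF C] by metis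
  have fin: "finite (covered m)" using covered_subset[OF m(1) C(2)] C(1) by (rule finite_subset)
  then have lt: "card (covered m) < n"
    using matching_of_pairing[OF m(1) fin \<open>even n\<close>] unsat by (metis not_le_imp_less)
  have PU: "\<Union>P = C - S" using partition_onD1[OF S(2)] by simp
  have finP: "finite P" using finite_elements[OF _ S(2)] C(1) by simp
  have finB: "finite B" if "B \<in> P" for B using PU that C(1) by (metis Union_upper finite_Diff finite_subset)
  have same: "B = B'" if "B \<in> P" "B' \<in> P" "v \<in> B" "v \<in> B'" for B B' v
    using partition_onD2[OF S(2)] that by (meson disjointD disjoint_iff)
  define Q where "Q = {B \<in> P. L < card B}"
  have Q: "Q \<subseteq> P" "finite Q" using finP by (auto simp: Q_def)
  define w :: "'a \<Rightarrow> nat" where "w v = (if v \<in> S then 2 else if v \<in> \<Union>Q then 1 else 0)" for v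
  have cardQ: "card (\<Union>Q) = (\<Sum>B\<in>Q. card B)"
  proof (rule card_Union_disjoint)
    show "disjoint Q" using partition_onD2[OF S(2)] Q(1) by (rule pairwise_subset)
  qed (use Q finB in blast)
  have UQ: "\<Union>Q \<subseteq> C" using Q(1) PU by blast
  have "card Q * L \<le> (\<Sum>B\<in>Q. card B)"
    using sum_bounded_below[of Q L card] by (simp add: Q_def less_imp_le)
  also have "\<dots> \<le> card C" using cardQ card_mono[OF C(1) UQ] by simp
  finally have cQ: "card Q \<le> card C div L" using \<open>0 < L\<close> by (simp add: less_eq_div_iff_mult_less_eq)
  have "(\<Sum>v\<in>C. w v) \<le> (\<Sum>v\<in>C. 2 * of_bool (v \<in> S) + of_bool (v \<in> \<Union>Q))"
    by (rule sum_mono) (simp add: w_def)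
  also have "\<dots> = 2 * card (C \<inter> S) + card (C \<inter> \<Union>Q)"
    using C(1) by (simp add: sum.distrib sum_distrib_left[symmetric] Int_def)
  also have "\<dots> \<le> 2 * card S + card (\<Union>Q)"
    using S(1) UQ by (simp add: Int_absorb1)
  \<comment> \<open>The summands \<open>1\<close> add up to \<open>card Q\<close>, which is at most
    \<open>card C div L\<close>.\<close>
  also have "card (\<Union>Q) \<le> (\<Sum>B\<in>Q. (card B - 1) + 1)"
    unfolding cardQ by (rule sum_mono) simp
  also have "\<dots> \<le> (\<Sum>B\<in>P. card B - 1) + card Q"
    using sum_mono2[OF finP Q(1), of "\<lambda>B. card B - 1"] by (simp only: sum.distrib) simp
  finally have "(\<Sum>v\<in>C. w v) \<le> n + card C div L" using m(2) lt cQ by linarith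
  moreover have "card {u \<in> C. {v, u} \<in> F \<and> w v + w u < 2} \<le> L" for v
  \<comment> \<open>An edge of total below \<open>2\<close> avoids the barrier, so it lies in a
    block. In a large block both ends have weight \<open>1\<close>, so such edges at
    \<open>v\<close> stay within a block of at most \<open>L\<close> vertices.\<close>
  proof (cases "\<exists>B\<in>P. v \<in> B \<and> card B \<le> L")
    case True
    then obtain B where B: "B \<in> P" "v \<in> B" "card B \<le> L" by blast
    have "{u \<in> C. {v, u} \<in> F \<and> w v + w u < 2} \<subseteq> B"
    proof
      fix u assume u: "u \<in> {u \<in> C. {v, u} \<in> F \<and> w v + w u < 2}"
      then have "v \<notin> S" "u \<notin> S" by (auto simp: w_def split: if_splits)
      then obtain B' where "B' \<in> P" "v \<in> B'" "u \<in> B'" using S(3)[of "{v, u}"] u by auto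
      then show "u \<in> B" using same B by blast
    qed
    then show ?thesis using card_mono[OF finB[OF B(1)]] B(3) by (meson le_trans)
  next
    case False
    have "{u \<in> C. {v, u} \<in> F \<and> w v + w u < 2} = {}"
    proof (rule ccontr)
      assume "{u \<in> C. {v, u} \<in> F \<and> w v + w u < 2} \<noteq> {}"
      then obtain u where u: "{v, u} \<in> F" "w v + w u < 2" by blast
      then have "v \<notin> S" "u \<notin> S" by (auto simp: w_def split: if_splits)
      then obtain B where B: "B \<in> P" "v \<in> B" "u \<in> B" using S(3)[OF u(1)] by auto
      then have "B \<in> Q" using False by (auto simp: Q_def)
      then have "w v = 1" "w u = 1" using B \<open>v \<notin> S\<close> \<open>u \<notin> S\<close> by (auto simp: w_def)
      then show False using u(2) by simp
    qed
    then show ?thesis by (simp only: card.empty le0)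
  qed
  moreover have "w v \<le> 2" for v by (simp add: w_def)
  ultimately show thesis using that by blast
qed

section \<open>Weights and states of a whole colour\<close>

lemma equiv_component_relation:
  "equiv V {(u, v). u \<in> V \<and> v \<in> V \<and> (u, v) \<in> {(x, y). {x, y} \<in> F}\<^sup>*}"
proof (rule equivI)
  have "sym {(x, y). {x, y} \<in> F}" by (auto simp: sym_def insert_commute)
  then have "sym ({(x, y). {x, y} \<in> F}\<^sup>*)" by (rule sym_rtrancl)
  then show "sym {(u, v). u \<in> V \<and> v \<in> V \<and> (u, v) \<in> {(x, y). {x, y} \<in> F}\<^sup>*}"
    by (auto simp: sym_def)
  show "trans {(u, v). u \<in> V \<and> v \<in> V \<and> (u, v) \<in> {(x, y). {x, y} \<in> F}\<^sup>*}"
    by (auto simp: trans_def)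
qed (auto simp: refl_on_def)

text \<open>The weights of the components are glued together, \<open>q v\<close> being the component
  of \<open>v\<close>. Edges do not leave components, so an exceptional edge at \<open>v\<close> is
  exceptional inside \<open>q v\<close>.\<close>

lemma colour_weights:
  assumes V: "finite V" "F \<subseteq> [V]\<^bsup>2\<^esup>" and "even n" "0 < L"
    and unsat: "\<And>C M. C \<in> graph_components V F \<Longrightarrow> component_matching F C M \<Longrightarrow> \<not> saturates M n"
  obtains q :: "'a \<Rightarrow> 'a set" and w :: "'a \<Rightarrow> nat" where "\<And>v. w v \<le> 2"
    "\<And>C. (\<Sum>v | v \<in> V \<and> q v = C. w v) \<le> n + card V div L"
    "\<And>v. v \<in> V \<Longrightarrow> card {u \<in> V. {v, u} \<in> F \<and> \<not> (q v = q u \<and> 2 \<le> w v + w u)} \<le> L"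
proof -
  define r where "r = {(u, v). u \<in> V \<and> v \<in> V \<and> (u, v) \<in> {(x, y). {x, y} \<in> F}\<^sup>*}"
  have r: "equiv V r" unfolding r_def by (rule equiv_component_relation)
  have comp: "graph_components V F = V // r" by (simp add: graph_components_def r_def)
  have "\<exists>w :: 'a \<Rightarrow> nat. (\<forall>v. w v \<le> 2) \<and> (\<Sum>v\<in>C. w v) \<le> n + card V div L \<and>
      (\<forall>v. card {u \<in> C. {v, u} \<in> {e \<in> F. e \<subseteq> C} \<and> w v + w u < 2} \<le> L)" if C: "C \<in> V // r" for C
  proof -
    have CV: "C \<subseteq> V" using C r by (meson in_quotient_imp_subset)
    then have finC: "finite C" using V(1) by (rule finite_subset)
    have sub: "{e \<in> F. e \<subseteq> C} \<subseteq> [C]\<^bsup>2\<^esup>" using V(2) by (auto simp: nsets_def)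
    have un: "\<not> saturates M n" if "matching {e \<in> F. e \<subseteq> C} M" for M
      using unsat[of C M] C comp that by (simp add: component_matching_def)
    obtain w :: "'a \<Rightarrow> nat" where w: "\<And>v. w v \<le> 2" "(\<Sum>v\<in>C. w v) \<le> n + card C div L"
        "\<And>v. card {u \<in> C. {v, u} \<in> {e \<in> F. e \<subseteq> C} \<and> w v + w u < 2} \<le> L"
    proof (rule component_weights[OF finC sub \<open>even n\<close> \<open>0 < L\<close>])
      show "\<not> saturates M n" if "matching {e \<in> F. e \<subseteq> C} M" for M using un[OF that] .
    qed (rule that)
    have "card C div L \<le> card V div L" by (intro div_le_mono card_mono V(1) CV)
    then have "(\<Sum>v\<in>C. w v) \<le> n + card V div L" using w(2) by linarith
    then show ?thesis using w(1,3) by (intro exI[of _ w] conjI allI)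
  qed
  then have "\<exists>wt :: 'a set \<Rightarrow> 'a \<Rightarrow> nat. \<forall>C\<in>V // r. (\<forall>v. wt C v \<le> 2) \<and> (\<Sum>v\<in>C. wt C v) \<le> n + card V div L \<and>
      (\<forall>v. card {u \<in> C. {v, u} \<in> {e \<in> F. e \<subseteq> C} \<and> wt C v + wt C u < 2} \<le> L)"
    by (intro bchoice ballI)
  then obtain wt :: "'a set \<Rightarrow> 'a \<Rightarrow> nat" where wt_all: "\<forall>C\<in>V // r. (\<forall>v. wt C v \<le> 2) \<and>
      (\<Sum>v\<in>C. wt C v) \<le> n + card V div L \<and>
      (\<forall>v. card {u \<in> C. {v, u} \<in> {e \<in> F. e \<subseteq> C} \<and> wt C v + wt C u < 2} \<le> L)" ..
  have wt: "wt C v \<le> 2" "(\<Sum>v\<in>C. wt C v) \<le> n + card V div L"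
      "card {u \<in> C. {v, u} \<in> {e \<in> F. e \<subseteq> C} \<and> wt C v + wt C u < 2} \<le> L" if "C \<in> V // r" for C v
    using bspec[OF wt_all that] by simp_all
  define q where "q v = r `` {v}" for v
  \<comment> \<open>Outside \<open>V\<close> the class \<open>q v\<close> is empty and not a
    component, so \<open>wt\<close> is unspecified there; the default \<open>0\<close> keeps
    \<open>w v \<le> 2\<close>.\<close>
  define w where "w v = (if v \<in> V then wt (q v) v else 0)" for v
  have qV: "q v \<in> V // r" if "v \<in> V" for v using that by (simp add: q_def quotientI)
  have fibre: "{v. v \<in> V \<and> q v = C} = C" if "C \<in> V // r" for C
  proof -
    have "q v = C \<longleftrightarrow> v \<in> C" if "v \<in> V" for v
      using r \<open>C \<in> V // r\<close> that unfolding q_def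
      by (metis Image_singleton_iff equiv_class_eq_iff equiv_class_self quotientE)
    moreover have "C \<subseteq> V" using that r by (meson in_quotient_imp_subset)
    ultimately show ?thesis by blast
  qed
  show thesis
  proof
    show "w v \<le> 2" for v using wt(1) qV by (simp add: w_def)
    show "(\<Sum>v | v \<in> V \<and> q v = C. w v) \<le> n + card V div L" for C
    proof (cases "C \<in> V // r")
      case True
      have "(\<Sum>v | v \<in> V \<and> q v = C. w v) = (\<Sum>v | v \<in> V \<and> q v = C. wt C v)"
        by (rule sum.cong) (auto simp: w_def)
      then show ?thesis using wt(2)[OF True] by (simp add: fibre[OF True])
    next
      case False
      then have "{v. v \<in> V \<and> q v = C} = {}" using qV by auto
      then show ?thesis by (simp only: sum.empty le0)
    qed
    show "card {u \<in> V. {v, u} \<in> F \<and> \<not> (q v = q u \<and> 2 \<le> w v + w u)} \<le> L" if v: "v \<in> V" for v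
    proof -
      have "{u \<in> V. {v, u} \<in> F \<and> \<not> (q v = q u \<and> 2 \<le> w v + w u)}
          \<subseteq> {u \<in> q v. {v, u} \<in> {e \<in> F. e \<subseteq> q v} \<and> wt (q v) v + wt (q v) u < 2}"
      proof
        fix u assume u: "u \<in> {u \<in> V. {v, u} \<in> F \<and> \<not> (q v = q u \<and> 2 \<le> w v + w u)}"
        then have "(v, u) \<in> r" using v by (auto simp: r_def)
        then have "q v = q u" "u \<in> q v" "v \<in> q v"
          using r v by (auto simp: q_def equiv_class_eq_iff intro: equiv_class_self)
        then show "u \<in> {u \<in> q v. {v, u} \<in> {e \<in> F. e \<subseteq> q v} \<and> wt (q v) v + wt (q v) u < 2}"
          using u v by (auto simp: w_def)
      qed
      moreover have "q v \<subseteq> V" using qV[OF v] r by (meson in_quotient_imp_subset)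
      then have "finite {u \<in> q v. {v, u} \<in> {e \<in> F. e \<subseteq> q v} \<and> wt (q v) v + wt (q v) u < 2}"
        using V(1) by (auto intro: finite_subset)
      ultimately show ?thesis using wt(3)[OF qV[OF v], of v] by (meson card_mono le_trans)
    qed
  qed
qed

text \<open>Merge classes while the union has at most \<open>N\<close> elements. If four groups remained, two disjoint
  pairs of them would have at least \<open>2 * N + 2\<close> elements together.\<close>

lemma three_groups:
  fixes q :: "'a \<Rightarrow> 'b"
  assumes "finite V" "card V = 2 * N + 1" and small: "\<And>x. card {v \<in> V. q v = x} \<le> N"
  obtains g :: "'b \<Rightarrow> nat" where "\<And>v. v \<in> V \<Longrightarrow> g (q v) < 3" "\<And>i. card {v \<in> V. g (q v) = i} \<le> N"
proof -
  define ok where "ok h \<longleftrightarrow> (\<forall>x. card {v \<in> V. h (q v) = x} \<le> N)" for h :: "'b \<Rightarrow> 'b"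
  have "ok id" using small by (simp add: ok_def)
  \<comment> \<open>\<open>h\<close> merges classes by renaming them; taking one with the fewest
    groups replaces repeated merging.\<close>
  then obtain h where h: "ok h" and min: "\<And>h'. ok h' \<Longrightarrow> card ((\<lambda>v. h (q v)) ` V) \<le> card ((\<lambda>v. h' (q v)) ` V)"
    using ex_has_least_nat[of ok id "\<lambda>h. card ((\<lambda>v. h (q v)) ` V)"] by blast
  define I where "I = (\<lambda>v. h (q v)) ` V"
  have finI: "finite I" using assms(1) by (simp add: I_def)
  let ?n = "\<lambda>x. card {v \<in> V. h (q v) = x}"
  have pair: "N < ?n a + ?n b" if ab: "a \<in> I" "b \<in> I" "a \<noteq> b" for a b
  proof (rule ccontr)
    assume le: "\<not> N < ?n a + ?n b"
    define h' where "h' x = (if h x = b then a else h x)" for x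
    have "card {v \<in> V. h' (q v) = x} \<le> N" for x
    proof (cases "x = a")
      case True
      have "{v \<in> V. h' (q v) = x} = {v \<in> V. h (q v) = a} \<union> {v \<in> V. h (q v) = b}"
        using True by (auto simp: h'_def)
      then show ?thesis using le card_Un_le[of "{v \<in> V. h (q v) = a}" "{v \<in> V. h (q v) = b}"] by simp
    next
      case False
      then have "{v \<in> V. h' (q v) = x} \<subseteq> {v \<in> V. h (q v) = x}" by (auto simp: h'_def split: if_splits)
      then have "card {v \<in> V. h' (q v) = x} \<le> ?n x" using assms(1) by (intro card_mono) auto
      also have "\<dots> \<le> N" using h by (simp add: ok_def)
      finally show ?thesis .
    qed
    then have "card I \<le> card ((\<lambda>v. h' (q v)) ` V)" using min by (simp add: ok_def I_def)
    moreover have "h' (q v) \<in> I - {b}" if "v \<in> V" for v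
      using ab that by (cases "h (q v) = b") (simp_all add: h'_def, simp add: I_def)
    then have "(\<lambda>v. h' (q v)) ` V \<subseteq> I - {b}" by blast
    then have "card ((\<lambda>v. h' (q v)) ` V) \<le> card (I - {b})" using finI by (intro card_mono) auto
    moreover have "card (I - {b}) < card I" using finI ab(2) by (rule card_Diff1_less)
    ultimately show False by simp
  qed
  have "card I \<le> 3"
  proof (rule ccontr)
    assume "\<not> card I \<le> 3"
    then have "4 \<le> card I" by simp
    then obtain T where T: "T \<subseteq> I" "card T = 4" by (metis obtain_subset_with_card_n)
    then obtain a b c d where abcd: "T = {a, b, c, d}" "distinct [a, b, c, d]"
      by (auto simp: card_Suc_eq eval_nat_numeral)
    have "(\<Sum>x\<in>T. ?n x) = card (\<Union>x\<in>T. {v \<in> V. h (q v) = x})"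
      using T(1) finI assms(1) by (intro card_UN_disjoint[symmetric]) (auto intro: finite_subset)
    also have "\<dots> \<le> card V" using assms(1) by (intro card_mono) auto
    finally have "?n a + ?n b + (?n c + ?n d) \<le> card V" using abcd by simp
    moreover have "N < ?n a + ?n b" "N < ?n c + ?n d" using T(1) abcd by (auto intro: pair)
    ultimately show False using assms(2) by linarith
  qed
  obtain e :: "'b \<Rightarrow> nat" and n where e: "e ` I = {i. i < n}" "inj_on e I"
    using finite_imp_inj_to_nat_seg[OF finI] by blast
  then have "n = card I" using card_image[OF e(2)] by simp
  show thesis
  proof (rule that[of "\<lambda>x. e (h x)"])
    show "e (h (q v)) < 3" if "v \<in> V" for v
    proof -
      have "h (q v) \<in> I" unfolding I_def using \<open>v \<in> V\<close> by (rule imageI)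
      then have "e (h (q v)) \<in> e ` I" by (rule imageI)
      then show ?thesis using e(1) \<open>card I \<le> 3\<close> \<open>n = card I\<close> by simp
    qed
    show "card {v \<in> V. e (h (q v)) = i} \<le> N" for i
    proof (cases "\<exists>x\<in>I. e x = i")
      case True
      then obtain x where x: "x \<in> I" "e x = i" by blast
      then have "{v \<in> V. e (h (q v)) = i} = {v \<in> V. h (q v) = x}"
        using e(2) by (auto simp: I_def inj_on_def)
      then show ?thesis using h by (simp add: ok_def)
    next
      case False
      then have "{v \<in> V. e (h (q v)) = i} = {}" by (auto simp: I_def)
      then show ?thesis by (simp only: card.empty le0)
    qed
  qed
qed

text \<open>The size \<open>2 * N + 1\<close> serves both cases: a class with more than
  \<open>N\<close> vertices leaves at most \<open>N\<close> outside, and if there is none, three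
  groups suffice.\<close>

lemma states_exist:
  fixes q :: "'a \<Rightarrow> 'b" and w :: "'a \<Rightarrow> nat"
  assumes V: "finite V" "card V = 2 * N + 1" and w: "\<And>v. w v \<le> 2"
    and sum: "\<And>x. (\<Sum>v | v \<in> V \<and> q v = x. w v) \<le> N"
  obtains k f where "bounded_states k V N f"
    "\<And>u v. u \<in> V \<Longrightarrow> v \<in> V \<Longrightarrow> q u = q v \<Longrightarrow> 2 \<le> w u + w v \<Longrightarrow> link k (f u) (f v)"
proof (cases "\<exists>x. N < card {v \<in> V. q v = x}")
  case True
  then obtain x where x: "N < card {v \<in> V. q v = x}" by blast
  define f where "f v = (if q v = x then (if w v = 0 then Z else if w v = 1 then H else W) else X)" for v
  show thesis
  proof (rule that[of True f])
    have "card (V \<inter> {v. f v = H}) + 2 * card (V \<inter> {v. f v = W}) = (\<Sum>v\<in>V. of_bool (f v = H) + 2 * of_bool (f v = W))"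
      using V(1) by (simp add: sum.distrib sum_distrib_left[symmetric])
    also have "\<dots> \<le> (\<Sum>v\<in>V. if q v = x then w v else 0)"
      by (rule sum_mono) (use w in \<open>auto simp: f_def\<close>)
    also have "\<dots> = (\<Sum>v | v \<in> V \<and> q v = x. w v)"
      using V(1) by (simp add: sum.If_cases Int_def)
    finally have "card (V \<inter> {v. f v = H}) + 2 * card (V \<inter> {v. f v = W}) \<le> N"
      using sum by (rule le_trans)
    moreover have "V \<inter> {v. f v = X} = V - {v \<in> V. q v = x}" by (auto simp: f_def)
    then have "card (V \<inter> {v. f v = X}) \<le> N"
      using V x by (simp add: card_Diff_subset)
    ultimately show "bounded_states True V N f" by (simp add: bounded_states_def)
    show "link True (f u) (f v)" if "q u = q v" "2 \<le> w u + w v" for u v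
    proof -
      have "w u \<in> {0, 1, 2}" "w v \<in> {0, 1, 2}" using w[of u] w[of v] by auto
      then show ?thesis using that by (auto simp: f_def)
    qed
  qed
next
  case False
  then have small: "card {v \<in> V. q v = x} \<le> N" for x by (simp add: not_less)
  obtain g :: "'b \<Rightarrow> nat" where g: "\<And>v. v \<in> V \<Longrightarrow> g (q v) < 3" "\<And>i. card {v \<in> V. g (q v) = i} \<le> N"
    using three_groups[OF V small] by blast
  define f where "f v = (if g (q v) = 0 then Z else if g (q v) = 1 then H else W)" for v
  show thesis
  proof (rule that[of False f])
    have "card (V \<inter> {v. f v = s}) \<le> N" for s
    proof -
      obtain i where "V \<inter> {v. f v = s} \<subseteq> {v \<in> V. g (q v) = i}"
      proof (cases s)
        case Z then show ?thesis by (intro that[of 0]) (auto simp: f_def split: if_splits)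
      next
        case H then show ?thesis by (intro that[of 1]) (auto simp: f_def split: if_splits)
      next
        case W then show ?thesis using g(1) by (intro that[of 2]) (force simp: f_def split: if_splits)
      next
        case X then show ?thesis by (intro that[of 0]) (auto simp: f_def split: if_splits)
      qed
      moreover have "finite {v \<in> V. g (q v) = i}" using V(1) by simp
      ultimately show ?thesis using g(2)[of i] by (meson card_mono le_trans)
    qed
    then show "bounded_states False V N f" by (auto simp: bounded_states_def f_def)
    show "link False (f u) (f v)" if "q u = q v" for u v using that by (simp add: f_def)
  qed
qed

text \<open>Components and weights are taken in the whole graph. Restriction to \<open>U\<close>
  only lowers the class weights and the number of exceptional edges at a vertex.\<close>

lemma colour_states:
  assumes V: "finite V" "F \<subseteq> [V]\<^bsup>2\<^esup>" and "even n" "0 < L"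
    and unsat: "\<And>C M. C \<in> graph_components V F \<Longrightarrow> component_matching F C M \<Longrightarrow> \<not> saturates M n"
    and U: "U \<subseteq> V" "card U = 2 * (n + card V div L) + 1"
  obtains k f where "bounded_states k U (n + card V div L) f"
    "\<And>v. v \<in> U \<Longrightarrow> card {u \<in> U. {v, u} \<in> F \<and> \<not> link k (f v) (f u)} \<le> L"
proof -
  define N where "N = n + card V div L"
  have ex: "\<exists>(q :: 'a \<Rightarrow> 'a set) (w :: 'a \<Rightarrow> nat). (\<forall>v. w v \<le> 2) \<and> (\<forall>C. (\<Sum>v | v \<in> V \<and> q v = C. w v) \<le> N) \<and>
    (\<forall>v\<in>V. card {u \<in> V. {v, u} \<in> F \<and> \<not> (q v = q u \<and> 2 \<le> w v + w u)} \<le> L)"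
  proof (rule colour_weights[OF V \<open>even n\<close> \<open>0 < L\<close>])
    show "\<not> saturates M n" if "C \<in> graph_components V F" "component_matching F C M" for C M
      using unsat[OF that] .
  qed (unfold N_def, blast)
  then obtain q :: "'a \<Rightarrow> 'a set" and w :: "'a \<Rightarrow> nat" where w: "\<forall>v. w v \<le> 2"
      "\<forall>C. (\<Sum>v | v \<in> V \<and> q v = C. w v) \<le> N"
      "\<forall>v\<in>V. card {u \<in> V. {v, u} \<in> F \<and> \<not> (q v = q u \<and> 2 \<le> w v + w u)} \<le> L"
    by blast
  have finU: "finite U" using U(1) V(1) by (rule finite_subset)
  have sumU: "(\<Sum>v | v \<in> U \<and> q v = C. w v) \<le> N" for C
  proof -
    have "(\<Sum>v | v \<in> U \<and> q v = C. w v) \<le> (\<Sum>v | v \<in> V \<and> q v = C. w v)"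
      using U(1) V(1) by (intro sum_mono2) auto
    then show ?thesis using w(2) by (meson le_trans)
  qed
  have cU: "card U = 2 * N + 1" using U(2) by (simp add: N_def)
  have w2: "w v \<le> 2" for v using w(1) by simp
  obtain k f where kf: "bounded_states k U N f"
      "\<And>u v. u \<in> U \<Longrightarrow> v \<in> U \<Longrightarrow> q u = q v \<Longrightarrow> 2 \<le> w u + w v \<Longrightarrow> link k (f u) (f v)"
    by (rule states_exist[OF finU cU w2 sumU]) (rule that)
  have "card {u \<in> U. {v, u} \<in> F \<and> \<not> link k (f v) (f u)} \<le> L" if v: "v \<in> U" for v
  proof -
    have "{u \<in> U. {v, u} \<in> F \<and> \<not> link k (f v) (f u)}
        \<subseteq> {u \<in> V. {v, u} \<in> F \<and> \<not> (q v = q u \<and> 2 \<le> w v + w u)}"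
      using kf(2)[OF v] U(1) by blast
    then have "card {u \<in> U. {v, u} \<in> F \<and> \<not> link k (f v) (f u)}
        \<le> card {u \<in> V. {v, u} \<in> F \<and> \<not> (q v = q u \<and> 2 \<le> w v + w u)}"
      using V(1) by (intro card_mono) auto
    also have "\<dots> \<le> L" using w(3) v U(1) by blast
    finally show ?thesis .
  qed
  then show thesis using that kf(1) unfolding N_def by blast
qed

section \<open>Degrees and the final contradiction\<close>

lemma vertex_degree_eq:
  assumes "simple_graph V E"
  shows "vertex_degree E v = card {u \<in> V. {v, u} \<in> E}"
proof -
  have "bij_betw (\<lambda>u. {v, u}) {u \<in> V. {v, u} \<in> E} {e \<in> E. v \<in> e}"
    unfolding bij_betw_def
  proof
    show "inj_on (\<lambda>u. {v, u}) {u \<in> V. {v, u} \<in> E}" by (auto simp: inj_on_def doubleton_eq_iff)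
    show "(\<lambda>u. {v, u}) ` {u \<in> V. {v, u} \<in> E} = {e \<in> E. v \<in> e}"
    proof (intro equalityI subsetI)
      fix e assume e: "e \<in> {e \<in> E. v \<in> e}"
      then have "card e = 2" "e \<subseteq> V" using assms by (auto simp: simple_graph_def nsets_def)
      then obtain u where "e = {v, u}" using e by (auto simp: card_2_iff insert_commute)
      then show "e \<in> (\<lambda>u. {v, u}) ` {u \<in> V. {v, u} \<in> E}" using e \<open>e \<subseteq> V\<close> by blast
    qed auto
  qed
  then show ?thesis by (simp add: vertex_degree_def bij_betw_same_card)
qed

text \<open>\<open>L\<close> is the block threshold: it bounds the exceptional edges at a vertex in
  each colour, and costs \<open>card V div L\<close> in the weight bound. A vertex unlinked to
  \<open>v\<close> in all colours is a non-neighbour or the end of an exceptional edge of its own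
  colour, so \<open>deg\<close> gives the bound \<open>N/4\<close>, and \<open>2 * N + 1\<close>
  vertices are too many.\<close>

lemma three_colouring_saturates:
  assumes G: "simple_graph V E" "c \<in> E \<rightarrow> {1, 2, 3}" and "even n" "0 < L"
    and large: "2 * (n + card V div L) + 1 \<le> card V"
    and deg: "\<And>v. v \<in> V \<Longrightarrow> 4 * (card V - vertex_degree E v + 3 * L) \<le> n"
  shows "\<exists>i \<in> {1, 2, 3}. \<exists>C \<in> graph_components V (colour_class E c i).
    \<exists>M. component_matching (colour_class E c i) C M \<and> saturates M n"
proof (rule ccontr)
  assume neg: "\<not> ?thesis"
  define N where "N = n + card V div L"
  have V: "finite V" "E \<subseteq> [V]\<^bsup>2\<^esup>" using G(1) by (auto simp: simple_graph_def)
  obtain U where U: "U \<subseteq> V" "card U = 2 * N + 1"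
    using obtain_subset_with_card_n[OF large] unfolding N_def by metis
  have states: "\<exists>k f. bounded_states k U N f \<and>
      (\<forall>v\<in>U. card {u \<in> U. {v, u} \<in> colour_class E c i \<and> \<not> link k (f v) (f u)} \<le> L)"
    if i: "i \<in> {1, 2, 3}" for i
  proof -
    have sub: "colour_class E c i \<subseteq> [V]\<^bsup>2\<^esup>" using V(2) by (auto simp: colour_class_def)
    show ?thesis
    proof (rule colour_states[OF V(1) sub \<open>even n\<close> \<open>0 < L\<close> _ U(1)])
      show "\<not> saturates M n" if "C \<in> graph_components V (colour_class E c i)"
        "component_matching (colour_class E c i) C M" for C M
        using neg i that by blast
    qed (use U(2) in \<open>auto simp: N_def\<close>)
  qed
  obtain k1 f1 where 1: "bounded_states k1 U N f1"
      "\<forall>v\<in>U. card {u \<in> U. {v, u} \<in> colour_class E c 1 \<and> \<not> link k1 (f1 v) (f1 u)} \<le> L"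
    using states[of 1] by auto
  obtain k2 f2 where 2: "bounded_states k2 U N f2"
      "\<forall>v\<in>U. card {u \<in> U. {v, u} \<in> colour_class E c 2 \<and> \<not> link k2 (f2 v) (f2 u)} \<le> L"
    using states[of 2] by auto
  obtain k3 f3 where 3: "bounded_states k3 U N f3"
      "\<forall>v\<in>U. card {u \<in> U. {v, u} \<in> colour_class E c 3 \<and> \<not> link k3 (f3 v) (f3 u)} \<le> L"
    using states[of 3] by auto
  have "config k1 k2 k3 U N f1 f2 f3"
    unfolding config_def
  proof (intro conjI ballI 1(1) 2(1) 3(1))
    show "finite U" using U(1) V(1) by (rule finite_subset)
    fix v assume v: "v \<in> U"
    define B where "B i k f = {u \<in> U. {v, u} \<in> colour_class E c i \<and> \<not> link k (f v) (f u)}" for i k f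
    have "{u \<in> U. \<not> (link k1 (f1 v) (f1 u) \<or> link k2 (f2 v) (f2 u) \<or> link k3 (f3 v) (f3 u))}
        \<subseteq> {u \<in> V. {v, u} \<notin> E} \<union> (B 1 k1 f1 \<union> (B 2 k2 f2 \<union> B 3 k3 f3))"
    proof
      fix u
      assume u: "u \<in> {u \<in> U. \<not> (link k1 (f1 v) (f1 u) \<or> link k2 (f2 v) (f2 u) \<or> link k3 (f3 v) (f3 u))}"
      show "u \<in> {u \<in> V. {v, u} \<notin> E} \<union> (B 1 k1 f1 \<union> (B 2 k2 f2 \<union> B 3 k3 f3))"
      proof (cases "{v, u} \<in> E")
        case True
        then have "c {v, u} \<in> {1, 2, 3}" using G(2) by blast
        then show ?thesis using u True by (auto simp: B_def colour_class_def)
      qed (use u U(1) in auto)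
    qed
    then have "card {u \<in> U. \<not> (link k1 (f1 v) (f1 u) \<or> link k2 (f2 v) (f2 u) \<or> link k3 (f3 v) (f3 u))}
        \<le> card ({u \<in> V. {v, u} \<notin> E} \<union> (B 1 k1 f1 \<union> (B 2 k2 f2 \<union> B 3 k3 f3)))"
      using V(1) \<open>finite U\<close> by (intro card_mono) (auto simp: B_def)
    also have "\<dots> \<le> card {u \<in> V. {v, u} \<notin> E} + (card (B 1 k1 f1) + (card (B 2 k2 f2) + card (B 3 k3 f3)))"
      by (intro order_trans[OF card_Un_le] add_mono order_refl)
    also have "\<dots> \<le> (card V - vertex_degree E v) + (L + (L + L))"
    proof (intro add_mono)
      \<comment> \<open>This set contains \<open>v\<close> itself, since edges have two elements;
        the difference \<open>card V - vertex_degree E v\<close> counts it as well.\<close>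
      have "{u \<in> V. {v, u} \<notin> E} = V - {u \<in> V. {v, u} \<in> E}" by blast
      then show "card {u \<in> V. {v, u} \<notin> E} \<le> card V - vertex_degree E v"
        using V(1) by (simp add: vertex_degree_eq[OF G(1)] card_Diff_subset)
    qed (use 1(2) 2(2) 3(2) v in \<open>auto simp: B_def\<close>)
    finally show "4 * card {u \<in> U. \<not> (link k1 (f1 v) (f1 u) \<or> link k2 (f2 v) (f2 u) \<or> link k3 (f3 v) (f3 u))} \<le> N"
      using deg[of v] v U(1) unfolding N_def by fastforce
  qed
  then have "card U \<le> 2 * N" by (rule config_card_le)
  then show False using U(2) by simp
qed

theorem theorem1p3:
  fixes \<eta> :: real
  assumes "\<eta> > 0"
  shows "\<exists>n\<^sub>0 :: nat. \<forall>n \<ge> n\<^sub>0. even n \<longrightarrow>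
    (\<forall>(V :: 'a set) E. simple_graph V E \<longrightarrow> has_order V ((2 + \<eta>) * real n) \<longrightarrow>
      real (min_degree V E) \<ge> (7 / 4 + 4 * \<eta>) * real n \<longrightarrow>
      (\<forall>c \<in> E \<rightarrow> {1, 2, 3}. \<exists>i \<in> {1, 2, 3}. \<exists>C \<in> graph_components V (colour_class E c i).
        \<exists>M. component_matching (colour_class E c i) C M \<and> saturates M n))"
proof -
  \<comment> \<open>\<open>K\<close> bounds \<open>card V / L\<close>, as \<open>card V\<close> is
    at most \<open>(3 + \<eta>) * n\<close> and \<open>L\<close> at least
    \<open>\<eta> * n / 4\<close>.\<close>
  define K where "K = 4 * (3 + \<eta>) / \<eta>"
  have K: "K > 4" using assms by (simp add: K_def field_simps)
  \<comment> \<open>This ensures \<open>2 * K + 2 \<le> \<eta> * n\<close>, that is,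
    \<open>2 * (n + K) + 1 \<le> (2 + \<eta>) * n - 1\<close>; the last \<open>1\<close> allows for
    rounding the order.\<close>
  define n\<^sub>0 where "n\<^sub>0 = nat \<lceil>(2 * K + 2) / \<eta>\<rceil>"
  show ?thesis
  proof (intro exI[of _ n\<^sub>0] allI impI ballI)
    fix n and V :: "'a set" and E and c :: "'a set \<Rightarrow> nat"
    assume n: "n \<ge> n\<^sub>0" "even n" and G: "simple_graph V E" "has_order V ((2 + \<eta>) * real n)"
      and deg: "real (min_degree V E) \<ge> (7 / 4 + 4 * \<eta>) * real n" and c: "c \<in> E \<rightarrow> {1, 2, 3}"
    \<comment> \<open>\<open>L\<close> grows linearly, which keeps \<open>card V div L\<close>
      bounded, while \<open>3 * L\<close> still fits into the slack \<open>4 * \<eta> * n\<close> of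
      the degree condition.\<close>
    define L where "L = nat \<lfloor>\<eta> * real n / 2\<rfloor>"
    have "(2 * K + 2) / \<eta> \<le> real n" using n(1) unfolding n\<^sub>0_def by linarith
    then have big: "2 * K + 2 \<le> \<eta> * real n" using assms by (simp add: field_simps)
    then have "0 < \<eta> * real n" using K by linarith
    then have n1: "1 \<le> real n" using assms by (cases "n = 0") auto
    have L: "real L \<le> \<eta> * real n / 2" "\<eta> * real n / 4 \<le> real L" "0 < L"
      using big K unfolding L_def by linarith+
    have ord: "(2 + \<eta>) * real n - 1 \<le> real (card V)" "real (card V) \<le> (2 + \<eta>) * real n + 1"
      using G(2) unfolding has_order_def by linarith+
    have "real (card V) \<le> (3 + \<eta>) * real n" using ord(2) n1 by (simp add: algebra_simps)
    then have "real (card V) / real L \<le> ((3 + \<eta>) * real n) / (\<eta> * real n / 4)"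
      using L assms n1 by (intro frac_le) auto
    also have "\<dots> = K" using assms n1 by (simp add: K_def field_simps)
    finally have "real (card V div L) \<le> K"
      using of_nat_div_le_of_nat[of "card V" L, where 'a = real] by linarith
    then have "real (2 * (n + card V div L) + 1) \<le> real (card V)"
      using ord(1) big by (simp add: algebra_simps)
    then have large: "2 * (n + card V div L) + 1 \<le> card V" by (simp only: of_nat_le_iff)
    have dg: "4 * (card V - vertex_degree E v + 3 * L) \<le> n" if v: "v \<in> V" for v
    proof -
      have fin: "finite V" using G(1) by (simp add: simple_graph_def)
      have "min_degree V E \<le> vertex_degree E v"
        unfolding min_degree_def using fin v by (intro Min_le) auto
      then have "(7 / 4 + 4 * \<eta>) * real n \<le> real (vertex_degree E v)" using deg by linarith
      moreover have "vertex_degree E v \<le> card V"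
        unfolding vertex_degree_eq[OF G(1)] using fin by (intro card_mono) auto
      \<comment> \<open>Before multiplication by \<open>4\<close> the left side is at most
        \<open>n/4 - (3/2) * \<eta> * n + 1\<close>, with \<open>1\<close> from rounding the order,
        and \<open>\<eta> * n\<close> is larger than \<open>1\<close>.\<close>
      ultimately have "real (4 * (card V - vertex_degree E v + 3 * L)) \<le> real n"
        using ord(2) L(1) big K by (simp add: of_nat_diff algebra_simps)
      then show ?thesis by (simp only: of_nat_le_iff)
    qed
    show "\<exists>i \<in> {1, 2, 3}. \<exists>C \<in> graph_components V (colour_class E c i).
        \<exists>M. component_matching (colour_class E c i) C M \<and> saturates M n"
      by (rule three_colouring_saturates[OF G(1) c n(2) L(3) large dg])
  qed
qed

end
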